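(* Let $F(X)$ be the free group on a finite set $X$ and let $K$ be a finitely generated subgroup of $F(X)$. Let $M$ be the unique minimal element (with respect to inclusion) among the algebraic extensions of $K$ which are malnormal in $F(X)$ (such an $M$ exists). Then $M=mal(K)$. In particular, $mal(K)$ is finitely generated and the extension $K\le mal(K)$ is algebraic. Moreover, there is an algorithm which, given a finite set of generators of $K$, outputs a finite set of generators for $mal(K)$.
   Context: Let $K \le H \le F(X)$. $H$ is a free extension of $K$ if there are subgroups $C \ne 1$ and $K'$ of $F(X)$ such that $K \le K'$ and $H = K' * C$ (internal free product). If $K \le H$ is not a free extension, it is called an algebraic extension. A subgroup $H$ of a group $G$ is malnormal in $G$ if $gHg^{-1}\cap H=1$ for every $g\in G-H$. For a finitely generated $K\le F(X)$, the malnormal closure is $$mal(K)=\bigcap\{H \mid K\le H\le F(X),\ H \text{ malnormal in } F(X)\}.$$ *)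

theory Defs
  imports "HOL-Algebra.Generated_Groups" "HOL-Library.Nat_Bijection"
begin

section \<open>The free group on a set\<close>

text \<open>A letter \<open>(x, True)\<close> stands for the generator \<open>x\<close>, and \<open>(x, False)\<close> for its inverse.
  Elements of the free group are the reduced words; the product is concatenation followed by
  free reduction.\<close>

type_synonym 'a word = "('a \<times> bool) list"

definition inv_letter :: "'a \<times> bool \<Rightarrow> 'a \<times> bool" where
  "inv_letter p = (fst p, \<not> snd p)"

definition reduced :: "'a word \<Rightarrow> bool" where
  "reduced w \<longleftrightarrow> successively (\<lambda>p q. q \<noteq> inv_letter p) w"

fun cancel_Cons :: "'a \<times> bool \<Rightarrow> 'a word \<Rightarrow> 'a word" where
  "cancel_Cons p [] = [p]"
| "cancel_Cons p (q # w) = (if q = inv_letter p then w else p # q # w)"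

definition reduce :: "'a word \<Rightarrow> 'a word" where
  "reduce w = foldr cancel_Cons w []"

definition free_group :: "'a set \<Rightarrow> 'a word monoid" where
  "free_group X =
    \<lparr>carrier = {w. set w \<subseteq> X \<times> UNIV \<and> reduced w},
     mult = (\<lambda>u v. reduce (u @ v)),
     one = []\<rparr>"

lemma inv_letter_inv_letter [simp]: "inv_letter (inv_letter p) = p"
  by (simp add: inv_letter_def)

lemma inv_letter_neq [simp]: "inv_letter p \<noteq> p" "p \<noteq> inv_letter p"
  by (simp_all add: inv_letter_def prod_eq_iff)

lemma reduced_cancel_Cons: "reduced w \<Longrightarrow> reduced (cancel_Cons p w)"
  unfolding reduced_def by (cases "(p, w)" rule: cancel_Cons.cases) (auto simp: successively_Cons)

lemma reduced_foldr: "reduced v \<Longrightarrow> reduced (foldr cancel_Cons u v)"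
  by (induction u) (auto simp: reduced_cancel_Cons)

lemma set_cancel_Cons: "set (cancel_Cons p w) \<subseteq> insert p (set w)"
  by (cases "(p, w)" rule: cancel_Cons.cases) auto

lemma set_foldr: "set (foldr cancel_Cons u v) \<subseteq> set u \<union> set v"
  by (induction u) (use set_cancel_Cons in fastforce)+

lemma cancel_Cons_inv: "reduced w \<Longrightarrow> cancel_Cons p (cancel_Cons (inv_letter p) w) = w"
  unfolding reduced_def
  by (cases "(p, w)" rule: cancel_Cons.cases; cases "tl w") (auto simp: successively_Cons)

lemma foldr_cancel_Cons:
  "reduced v \<Longrightarrow> foldr cancel_Cons (cancel_Cons p w) v = cancel_Cons p (foldr cancel_Cons w v)"
  by (cases "(p, w)" rule: cancel_Cons.cases) (auto simp: cancel_Cons_inv reduced_foldr)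

lemma foldr_foldr:
  "reduced v \<Longrightarrow> foldr cancel_Cons (foldr cancel_Cons u w) v
     = foldr cancel_Cons u (foldr cancel_Cons w v)"
  by (induction u) (auto simp: foldr_cancel_Cons)

lemma reduce_reduced: "reduced w \<Longrightarrow> reduce w = w"
proof (induction w)
  case (Cons p w)
  then show ?case
    by (cases w) (auto simp: reduce_def reduced_def)
qed (simp add: reduce_def)

lemma reduce_append: "reduced v \<Longrightarrow> reduce (u @ v) = foldr cancel_Cons u v"
  using reduce_reduced[of v] by (simp add: reduce_def)

lemma reduced_reduce: "reduced (reduce w)"
  unfolding reduce_def by (rule reduced_foldr) (simp add: reduced_def)

lemma foldr_inverse:
  "reduced v \<Longrightarrow> foldr cancel_Cons (rev (map inv_letter u)) (foldr cancel_Cons u v) = v"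
proof (induction u)
  case (Cons p u)
  then show ?case
    using cancel_Cons_inv[of "foldr cancel_Cons u v" "inv_letter p"] by (simp add: reduced_foldr)
qed simp

theorem group_free_group: "group (free_group X)"
proof (rule groupI)
  fix u v w assume "u \<in> carrier (free_group X)" "v \<in> carrier (free_group X)"
    "w \<in> carrier (free_group X)"
  then show "u \<otimes>\<^bsub>free_group X\<^esub> v \<otimes>\<^bsub>free_group X\<^esub> w
      = u \<otimes>\<^bsub>free_group X\<^esub> (v \<otimes>\<^bsub>free_group X\<^esub> w)"
    by (simp add: free_group_def reduce_append reduced_foldr foldr_foldr)
next
  fix u assume u: "u \<in> carrier (free_group X)"
  let ?v = "rev (map inv_letter u)"
  have "reduce ?v \<in> carrier (free_group X)"
    using u set_foldr[of ?v "[]"]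
    by (fastforce simp: free_group_def reduced_reduce reduce_def inv_letter_def reduced_foldr
        reduced_def[of "[]"])
  moreover have "reduce ?v \<otimes>\<^bsub>free_group X\<^esub> u = \<one>\<^bsub>free_group X\<^esub>"
  proof -
    have u': "reduced u" "reduced []" using u by (auto simp: free_group_def reduced_def)
    have "reduce (reduce ?v @ u) = foldr cancel_Cons (foldr cancel_Cons ?v []) u"
      using u' by (simp add: reduce_append reduce_def[of ?v])
    also have "\<dots> = foldr cancel_Cons ?v u"
      using u' foldr_foldr[of u ?v "[]"] by simp
    also have "\<dots> = foldr cancel_Cons ?v (foldr cancel_Cons u [])"
      using reduce_reduced[OF u'(1)] by (simp add: reduce_def)
    also have "\<dots> = []" by (rule foldr_inverse[OF u'(2)])
    finally show ?thesis by (simp add: free_group_def)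
  qed
  ultimately show "\<exists>v\<in>carrier (free_group X). v \<otimes>\<^bsub>free_group X\<^esub> u = \<one>\<^bsub>free_group X\<^esub>"
    by blast
next
  fix u v assume "u \<in> carrier (free_group X)" "v \<in> carrier (free_group X)"
  then show "u \<otimes>\<^bsub>free_group X\<^esub> v \<in> carrier (free_group X)"
    using set_foldr[of u v] by (auto simp: free_group_def reduced_foldr reduce_append)
next
  fix u assume "u \<in> carrier (free_group X)"
  then show "\<one>\<^bsub>free_group X\<^esub> \<otimes>\<^bsub>free_group X\<^esub> u = u"
    by (simp add: free_group_def reduce_reduced)
qed (simp add: free_group_def reduced_def)


section \<open>Free and algebraic extensions, malnormality\<close>

definition finitely_generated :: "('g, 'b) monoid_scheme \<Rightarrow> 'g set \<Rightarrow> bool" where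
  "finitely_generated G H \<longleftrightarrow> (\<exists>S. finite S \<and> S \<subseteq> carrier G \<and> H = generate G S)"

text \<open>\<open>H = A * B\<close>: the subgroups \<open>A\<close> and \<open>B\<close> generate \<open>H\<close>, and no nonempty alternating product
  of nontrivial elements of \<open>A\<close> and \<open>B\<close> is trivial.  The boolean tag of a syllable says from which
  factor it is taken, so the condition also forces \<open>A\<close> and \<open>B\<close> to meet trivially.\<close>

definition internal_free_product ::
    "('g, 'b) monoid_scheme \<Rightarrow> 'g set \<Rightarrow> 'g set \<Rightarrow> 'g set \<Rightarrow> bool" where
  "internal_free_product G A B H \<longleftrightarrow>
     subgroup A G \<and> subgroup B G \<and> H = generate G (A \<union> B) \<and>
     (\<forall>ps. ps \<noteq> [] \<and>
           (\<forall>(t, g) \<in> set ps. g \<in> (if t then A else B) - {\<one>\<^bsub>G\<^esub>}) \<and>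
           distinct_adj (map fst ps) \<longrightarrow>
           foldr (\<otimes>\<^bsub>G\<^esub>) (map snd ps) \<one>\<^bsub>G\<^esub> \<noteq> \<one>\<^bsub>G\<^esub>)"

definition free_extension :: "('g, 'b) monoid_scheme \<Rightarrow> 'g set \<Rightarrow> 'g set \<Rightarrow> bool" where
  "free_extension G K H \<longleftrightarrow>
     subgroup K G \<and> subgroup H G \<and> K \<subseteq> H \<and>
     (\<exists>K' C. subgroup K' G \<and> subgroup C G \<and> C \<noteq> {\<one>\<^bsub>G\<^esub>} \<and> K \<subseteq> K' \<and>
             internal_free_product G K' C H)"

definition algebraic_extension :: "('g, 'b) monoid_scheme \<Rightarrow> 'g set \<Rightarrow> 'g set \<Rightarrow> bool" where
  "algebraic_extension G K H \<longleftrightarrow>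
     subgroup K G \<and> subgroup H G \<and> K \<subseteq> H \<and> \<not> free_extension G K H"

definition malnormal :: "('g, 'b) monoid_scheme \<Rightarrow> 'g set \<Rightarrow> bool" where
  "malnormal G H \<longleftrightarrow>
     subgroup H G \<and>
     (\<forall>g \<in> carrier G - H. ((g <#\<^bsub>G\<^esub> H) #>\<^bsub>G\<^esub> inv\<^bsub>G\<^esub> g) \<inter> H = {\<one>\<^bsub>G\<^esub>})"

definition mal :: "('g, 'b) monoid_scheme \<Rightarrow> 'g set \<Rightarrow> 'g set" where
  "mal G K = \<Inter>{H. subgroup H G \<and> K \<subseteq> H \<and> malnormal G H}"

definition inclusion_minimal :: "'g set set \<Rightarrow> 'g set \<Rightarrow> bool" where
  "inclusion_minimal \<A> M \<longleftrightarrow> M \<in> \<A> \<and> (\<forall>H\<in>\<A>. H \<subseteq> M \<longrightarrow> H = M)"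


section \<open>Algorithms\<close>

text \<open>The total recursive functions of arity \<open>k\<close>: the closure of the basic functions under
  composition, primitive recursion and minimization of regular functions (those having a zero for
  every choice of the parameters).  A \<open>k\<close>-ary function is represented by its action on argument
  lists of length \<open>k\<close>; its values on other lists are irrelevant.\<close>

inductive recursive :: "nat \<Rightarrow> (nat list \<Rightarrow> nat) \<Rightarrow> bool" where
  zero: "recursive k (\<lambda>_. 0)"
| suc: "recursive 1 (\<lambda>xs. Suc (xs ! 0))"
| proj: "i < k \<Longrightarrow> recursive k (\<lambda>xs. xs ! i)"
| comp: "recursive (length gs) f \<Longrightarrow> (\<forall>g \<in> set gs. recursive k g) \<Longrightarrow>
    recursive k (\<lambda>xs. f (map (\<lambda>g. g xs) gs))"
| prim_rec: "recursive k f \<Longrightarrow> recursive (Suc (Suc k)) h \<Longrightarrow>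
    recursive (Suc k) (\<lambda>xs. rec_nat (f (tl xs)) (\<lambda>n r. h (n # r # tl xs)) (hd xs))"
| minim: "recursive (Suc k) f \<Longrightarrow> (\<forall>xs. length xs = k \<longrightarrow> (\<exists>n. f (n # xs) = 0)) \<Longrightarrow>
    recursive k (\<lambda>xs. LEAST n. f (n # xs) = 0)"

definition computable :: "(nat \<Rightarrow> nat) \<Rightarrow> bool" where
  "computable f \<longleftrightarrow> (\<exists>r. recursive 1 r \<and> (\<forall>n. f n = r [n]))"

text \<open>Codes of words and of lists of words, relative to a numbering \<open>e\<close> of the alphabet.\<close>

definition word_code :: "('a \<Rightarrow> nat) \<Rightarrow> 'a word \<Rightarrow> nat" where
  "word_code e w = list_encode (map (\<lambda>(x, b). prod_encode (e x, of_bool b)) w)"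

definition words_code :: "('a \<Rightarrow> nat) \<Rightarrow> 'a word list \<Rightarrow> nat" where
  "words_code e ws = list_encode (map (word_code e) ws)"

end

theory Submission
  imports Defs
begin

text \<open>A subgroup \<open>M\<close> is malnormal iff \<open>h\<close>, \<open>g h g\<inverse> \<in> M\<close> and \<open>h \<noteq> 1\<close> imply \<open>g \<in> M\<close>. Intersections of
  malnormal subgroups are malnormal, and so are free factors of malnormal subgroups (compare normal
  forms). Hence \<open>mal K\<close> is malnormal, it has no proper free factor containing \<open>K\<close>, and it is the
  least malnormal algebraic extension of \<open>K\<close>.

  For \<open>K\<close> generated by a finite set \<open>U\<close>, take a finite subtree \<open>V\<close> of the Cayley tree containing \<open>1\<close>
  and \<open>U\<close>, and call an equivalence relation on \<open>V\<close> good if it identifies \<open>U\<close> with \<open>1\<close>, is closed under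
  Stallings folding, and no nontrivial reduced word labels loops at two different vertices of the
  quotient graph. The loop group of the quotient, generated by the elements \<open>p\<inverse> q\<close> with \<open>p ~ q\<close>, is
  then malnormal and contains \<open>K\<close>. Conversely \<open>p\<inverse> q \<in> mal K\<close> is a good relation, and it is the
  least one. So \<open>mal K\<close> is finitely generated. As relations on \<open>V\<close> are coded by numbers below an
  explicit bound, the least good relation is defined by bounded quantifiers, hence computable.\<close>

section \<open>Malnormal subgroups and free factors\<close>

text \<open>Left multiplication by a letter \<open>a\<close> is the edge from \<open>p\<close> to
  \<open>a p\<close>. So words are read from right to left, subtrees through \<open>1\<close> are
  suffix-closed sets of reduced words, and \<open>p\<inverse> q \<in> M\<close> says that
  \<open>p\<close> and \<open>q\<close> represent the same left coset of \<open>M\<close>. A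
  relation on \<open>V\<close> is a partial picture of a coset graph, and its loop group is the
  fundamental group of that picture.

  The obstacle is that malnormality speaks about loops of unbounded length. A common loop at two
  different vertices is a cycle without backtracking, off the diagonal of the fibre product of the
  folded graph with itself. In a finite graph such a cycle exists iff some nonempty set of
  off-diagonal edges can be continued forever inside itself. This turns the condition into one about
  subsets of a finite set, which a bounded search can check.

  The vertex set can be fixed in advance, without any folding procedure: the coset relation of
  \<open>mal K\<close> on any finite subtree through the generators is already good. Its loop group
  is contained in \<open>mal K\<close> and, being malnormal, contains it; this is where finite
  generation comes from.\<close>

context group
begin

lemma conj_eq_one_iff:
  "g \<in> carrier G \<Longrightarrow> h \<in> carrier G \<Longrightarrow> g \<otimes> h \<otimes> inv g = \<one> \<longleftrightarrow> h = \<one>"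
  using inv_solve_right'[of \<one> "g \<otimes> h" g] by auto

lemma conj_mult:
  assumes "x \<in> carrier G" "y \<in> carrier G" "h \<in> carrier G"
  shows "x \<otimes> y \<otimes> h \<otimes> inv (x \<otimes> y) = x \<otimes> (y \<otimes> h \<otimes> inv y) \<otimes> inv x"
  using assms by (simp add: inv_mult_group m_assoc)

lemma inv_conj_conj:
  assumes "g \<in> carrier G" "h \<in> carrier G"
  shows "inv g \<otimes> (g \<otimes> h \<otimes> inv g) \<otimes> g = h"
  using conj_mult[of "inv g" g h] assms by simp

lemma conj_coset_iff:
  assumes "subgroup H G" "g \<in> carrier G"
  shows "x \<in> (g <# H) #> inv g \<longleftrightarrow> (\<exists>h\<in>H. x = g \<otimes> h \<otimes> inv g)"
  unfolding l_coset_def r_coset_def by auto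

text \<open>The identity always lies in the intersection, so triviality of the intersection is a
  condition on nontrivial \<open>h\<close> alone. All later arguments use this elementwise
  form.\<close>

lemma malnormal_iff:
  "malnormal G H \<longleftrightarrow> subgroup H G \<and>
     (\<forall>g\<in>carrier G. \<forall>h\<in>H. h \<noteq> \<one> \<longrightarrow> g \<otimes> h \<otimes> inv g \<in> H \<longrightarrow> g \<in> H)"
proof (cases "subgroup H G")
  case True
  have "((g <# H) #> inv g) \<inter> H = {\<one>} \<longleftrightarrow> (\<forall>h\<in>H. g \<otimes> h \<otimes> inv g \<in> H \<longrightarrow> h = \<one>)"
    if g: "g \<in> carrier G" for g
  proof -
    have one: "g \<otimes> h \<otimes> inv g = \<one> \<longleftrightarrow> h = \<one>" if "h \<in> H" for h
      using conj_eq_one_iff[OF g] subgroup.mem_carrier[OF True that] .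
    have "\<one> \<in> ((g <# H) #> inv g) \<inter> H"
      unfolding Int_iff conj_coset_iff[OF True g]
      using True g by (auto intro!: bexI[of _ \<one>] simp: subgroup.one_closed)
    then show ?thesis
      unfolding set_eq_iff Int_iff conj_coset_iff[OF True g] using one by auto
  qed
  then show ?thesis unfolding malnormal_def using True by blast
qed (simp add: malnormal_def)

lemma malnormalD:
  "malnormal G H \<Longrightarrow> g \<in> carrier G \<Longrightarrow> h \<in> H \<Longrightarrow> h \<noteq> \<one> \<Longrightarrow> g \<otimes> h \<otimes> inv g \<in> H \<Longrightarrow> g \<in> H"
  unfolding malnormal_iff by blast

lemma malnormal_subgroup: "malnormal G H \<Longrightarrow> subgroup H G"
  unfolding malnormal_def by blast

lemma malnormal_carrier: "malnormal G (carrier G)"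
  unfolding malnormal_iff using subgroup_self by blast

lemma mal_subset: "malnormal G H \<Longrightarrow> K \<subseteq> H \<Longrightarrow> mal G K \<subseteq> H"
  unfolding mal_def using malnormal_subgroup by blast

lemma subset_mal: "K \<subseteq> mal G K"
  unfolding mal_def by blast

lemma malnormal_mal:
  assumes "K \<subseteq> carrier G" shows "malnormal G (mal G K)"
proof -
  let ?S = "{H. subgroup H G \<and> K \<subseteq> H \<and> malnormal G H}"
  have "carrier G \<in> ?S" using assms subgroup_self malnormal_carrier by blast
  then have "subgroup (mal G K) G"
    unfolding mal_def by (intro subgroups_Inter) auto
  moreover have "g \<in> mal G K"
    if "g \<in> carrier G" "h \<in> mal G K" "h \<noteq> \<one>" "g \<otimes> h \<otimes> inv g \<in> mal G K" for g h
    unfolding mal_def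
  proof (rule InterI)
    fix H assume H: "H \<in> ?S"
    then show "g \<in> H"
      using malnormalD[of H g h] that(1,3) InterD[OF that(2)[unfolded mal_def] H]
        InterD[OF that(4)[unfolded mal_def] H] by simp
  qed
  ultimately show ?thesis unfolding malnormal_iff by blast
qed

section \<open>Normal forms in an internal free product\<close>

definition alternating :: "'a set \<Rightarrow> 'a set \<Rightarrow> (bool \<times> 'a) list \<Rightarrow> bool" where
  "alternating A B ps \<longleftrightarrow>
     (\<forall>(t, g) \<in> set ps. g \<in> (if t then A else B) - {\<one>}) \<and> distinct_adj (map fst ps)"

definition syllable_prod :: "(bool \<times> 'a) list \<Rightarrow> 'a" where
  "syllable_prod ps = foldr (\<otimes>) (map snd ps) \<one>"

definition inv_syllables :: "(bool \<times> 'a) list \<Rightarrow> (bool \<times> 'a) list" where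
  "inv_syllables ps = rev (map (map_prod id (m_inv G)) ps)"

lemma internal_free_productD:
  assumes "internal_free_product G A B H"
  shows "subgroup A G" "subgroup B G" "H = generate G (A \<union> B)"
    "\<And>ps. alternating A B ps \<Longrightarrow> syllable_prod ps = \<one> \<Longrightarrow> ps = []"
  using assms unfolding internal_free_product_def alternating_def syllable_prod_def by blast+

lemma internal_free_product_subset:
  assumes "internal_free_product G A B H"
  shows "A \<subseteq> H" "B \<subseteq> H"
proof -
  have "A \<union> B \<subseteq> H"
    unfolding internal_free_productD(3)[OF assms] by (rule subsetI) (rule generate.incl)
  then show "A \<subseteq> H" "B \<subseteq> H" by simp_all
qed

lemma alternating_append:
  "alternating A B (ps @ qs) \<longleftrightarrow> alternating A B ps \<and> alternating A B qs \<and>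
     (ps = [] \<or> qs = [] \<or> fst (last ps) \<noteq> fst (hd qs))"
  unfolding alternating_def by (auto simp: distinct_adj_append_iff last_map hd_map)

lemma alternating_Nil [simp]: "alternating A B []"
  by (simp add: alternating_def)

lemma alternating_singleton [simp]:
  "alternating A B [(t, g)] \<longleftrightarrow> g \<in> (if t then A else B) - {\<one>}"
  by (simp add: alternating_def)

lemma alternating_Cons:
  "alternating A B (p # ps) \<longleftrightarrow> alternating A B [p] \<and> alternating A B ps \<and>
     (ps = [] \<or> fst p \<noteq> fst (hd ps))"
  using alternating_append[of A B "[p]" ps] by simp

lemma alternating_carrier:
  assumes "subgroup A G" "subgroup B G" "alternating A B ps"
  shows "snd ` set ps \<subseteq> carrier G"
  using assms(3) subgroup.subset[OF assms(1)] subgroup.subset[OF assms(2)]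
  unfolding alternating_def by (fastforce split: if_splits)

lemma syllable_prod_closed: "snd ` set ps \<subseteq> carrier G \<Longrightarrow> syllable_prod ps \<in> carrier G"
  by (induction ps) (auto simp: syllable_prod_def)

lemma syllable_prod_append:
  assumes "snd ` set ps \<subseteq> carrier G" "snd ` set qs \<subseteq> carrier G"
  shows "syllable_prod (ps @ qs) = syllable_prod ps \<otimes> syllable_prod qs"
  using assms
proof (induction ps)
  case Nil
  then show ?case using syllable_prod_closed[of qs] by (simp add: syllable_prod_def)
next
  case (Cons p ps)
  then show ?case
    using syllable_prod_closed[of qs] syllable_prod_closed[of ps]
    by (simp add: syllable_prod_def m_assoc)
qed

lemma syllable_prod_Nil [simp]: "syllable_prod [] = \<one>"
  by (simp add: syllable_prod_def)

lemma syllable_prod_Cons [simp]: "syllable_prod (p # ps) = snd p \<otimes> syllable_prod ps"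
  by (simp add: syllable_prod_def)

lemma inv_syllables_Cons: "inv_syllables (p # ps) = inv_syllables ps @ [(fst p, inv (snd p))]"
  by (cases p) (simp add: inv_syllables_def)

lemma inv_syllables_carrier:
  "snd ` set ps \<subseteq> carrier G \<Longrightarrow> snd ` set (inv_syllables ps) \<subseteq> carrier G"
  by (auto simp: inv_syllables_def)

lemma syllable_prod_inv_syllables:
  assumes "snd ` set ps \<subseteq> carrier G"
  shows "syllable_prod (inv_syllables ps) = inv (syllable_prod ps)"
  using assms
proof (induction ps)
  case (Cons p ps)
  then have "syllable_prod (inv_syllables (p # ps)) = inv (syllable_prod ps) \<otimes> inv (snd p)"
    using inv_syllables_carrier[of ps]
    by (simp add: inv_syllables_Cons syllable_prod_append)
  also have "\<dots> = inv (snd p \<otimes> syllable_prod ps)"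
    using Cons.prems syllable_prod_closed[of ps] by (simp add: inv_mult_group)
  finally show ?case by simp
qed (simp add: inv_syllables_def)

lemma alternating_inv_syllables:
  assumes "subgroup A G" "subgroup B G" "alternating A B ps"
  shows "alternating A B (inv_syllables ps)"
proof -
  have "inv g \<in> C - {\<one>}" if "g \<in> C - {\<one>}" "subgroup C G" for g C
    using that subgroup.m_inv_closed[of C G g] subgroup.mem_carrier[of C G g]
    by (auto simp: inv_eq_1_iff)
  moreover have "map fst (inv_syllables ps) = rev (map fst ps)"
    by (simp add: inv_syllables_def rev_map)
  ultimately show ?thesis
    using assms unfolding alternating_def
    by (auto simp: inv_syllables_def distinct_adj_rev split: if_splits)
qed

text \<open>The factor \<open>g\<close> is dropped if trivial, becomes a new syllable if the head
  comes from the other factor, and is otherwise merged with the head. If the merged syllable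
  vanishes, the tail is already alternating, so there is no cascade of cancellations.\<close>

lemma syllable_Cons_normal_form:
  assumes A: "subgroup A G" and B: "subgroup B G" and ps: "alternating A B ps"
    and g: "g \<in> (if t then A else B)"
  shows "\<exists>qs. alternating A B qs \<and> syllable_prod qs = g \<otimes> syllable_prod ps"
proof -
  have car: "snd ` set ps \<subseteq> carrier G" by (rule alternating_carrier[OF A B ps])
  have g': "g \<in> carrier G"
    using g subgroup.mem_carrier[OF A] subgroup.mem_carrier[OF B] by (cases t) auto
  consider "g = \<one>" | "g \<noteq> \<one>" "ps = [] \<or> fst (hd ps) \<noteq> t"
    | h qs where "g \<noteq> \<one>" "ps = (t, h) # qs"
    by (cases ps) (auto simp: prod_eq_iff)
  then show ?thesis
  proof cases
    case 1
    then show ?thesis using ps syllable_prod_closed[OF car] by auto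
  next
    case 2
    then show ?thesis
      using g ps by (intro exI[of _ "(t, g) # ps"]) (auto simp: alternating_Cons[of _ _ _ ps])
  next
    case 3
    have h: "h \<in> (if t then A else B)" "alternating A B qs" "qs = [] \<or> fst (hd qs) \<noteq> t"
      using ps unfolding 3 by (auto simp: alternating_Cons[of _ _ _ qs] split: if_splits)
    have gh: "g \<otimes> h \<in> (if t then A else B)"
      using g h(1) subgroup.m_closed[OF A] subgroup.m_closed[OF B] by (cases t) auto
    have "h \<in> carrier G" "syllable_prod qs \<in> carrier G"
      using car 3 syllable_prod_closed[of qs] by auto
    then have eq: "g \<otimes> syllable_prod ps = g \<otimes> h \<otimes> syllable_prod qs"
      using g' by (simp add: 3 m_assoc)
    show ?thesis
    proof (cases "g \<otimes> h = \<one>")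
      case True
      then show ?thesis using eq h(2) \<open>syllable_prod qs \<in> carrier G\<close> by auto
    next
      case False
      then show ?thesis using eq h gh
        by (intro exI[of _ "(t, g \<otimes> h) # qs"]) (auto simp: alternating_Cons[of _ _ _ qs])
    qed
  qed
qed

text \<open>Two alternating lists may cancel arbitrarily deep at their junction. The induction
  avoids this by proving that \<open>g\<close> can be multiplied onto any alternating list,
  absorbing one factor element at a time; the empty list gives the claim.\<close>

lemma generate_normal_form:
  assumes A: "subgroup A G" and B: "subgroup B G" and g: "g \<in> generate G (A \<union> B)"
  shows "\<exists>qs. alternating A B qs \<and> syllable_prod qs = g"
proof -
  have mem: "\<exists>t. h \<in> (if t then A else B)" if "h \<in> A \<union> B" for h
    using that by (metis UnE)
  have car: "A \<union> B \<subseteq> carrier G"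
    using subgroup.subset A B by blast
  have "\<exists>qs. alternating A B qs \<and> syllable_prod qs = g \<otimes> syllable_prod ps"
    if "alternating A B ps" for ps
    using g that
  proof (induction arbitrary: ps)
    case one
    then show ?case
      using syllable_prod_closed[OF alternating_carrier[OF A B]] by auto
  next
    case (incl h)
    then show ?case using syllable_Cons_normal_form[OF A B] mem by blast
  next
    case (inv h)
    then have "inv h \<in> A \<union> B"
      using subgroup.m_inv_closed[OF A] subgroup.m_inv_closed[OF B] by auto
    then show ?case using inv syllable_Cons_normal_form[OF A B] mem by blast
  next
    case (eng h1 h2)
    obtain qs where qs: "alternating A B qs" "syllable_prod qs = h2 \<otimes> syllable_prod ps"
      using eng by blast
    obtain rs where "alternating A B rs" "syllable_prod rs = h1 \<otimes> syllable_prod qs"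
      using eng qs by blast
    moreover have "h1 \<in> carrier G" "h2 \<in> carrier G"
      using eng.hyps generate_in_carrier[OF car] by blast+
    ultimately show ?case
      using qs syllable_prod_closed[OF alternating_carrier[OF A B eng.prems]]
      by (auto simp: m_assoc)
  qed
  from this[of "[]"] show ?thesis
    using generate_in_carrier[OF car g] by simp
qed

text \<open>\<open>A\<close>-syllables at either end of the normal form of \<open>g\<close> can be
  stripped, because conjugation by them preserves \<open>A\<close>. What remains is empty, or begins
  and ends with \<open>B\<close>-syllables; the latter is impossible.\<close>

lemma free_factor_malnormal:
  assumes fp: "internal_free_product G A B H"
    and g: "g \<in> H" and a: "a \<in> A" "a \<noteq> \<one>" and a': "g \<otimes> a \<otimes> inv g \<in> A"
  shows "g \<in> A"
proof -
  note A = internal_free_productD(1)[OF fp] and B = internal_free_productD(2)[OF fp]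
  note AC = subgroup.mem_carrier[OF A]
  \<comment> \<open>The equation \<open>g b g\<inverse> = b'\<close>, written as a product equal to
    the identity, is alternating as it stands: the syllables from \<open>A\<close> are separated by
    \<open>ps\<close> and its inverse, which have \<open>B\<close>-syllables at both ends.\<close>
  have ends: False if "alternating A B ps" "ps \<noteq> []" "\<not> fst (last ps)" "\<not> fst (hd ps)"
      "b \<in> A" "b \<noteq> \<one>" "syllable_prod ps \<otimes> b \<otimes> inv (syllable_prod ps) \<in> A" for ps b
  proof -
    let ?g = "syllable_prod ps" and ?b' = "syllable_prod ps \<otimes> b \<otimes> inv (syllable_prod ps)"
    have car: "snd ` set ps \<subseteq> carrier G" by (rule alternating_carrier[OF A B that(1)])
    note car' = inv_syllables_carrier[OF car]
    have gc: "?g \<in> carrier G" by (rule syllable_prod_closed[OF car])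
    have bc: "b \<in> carrier G" using that AC by blast
    have b'1: "?b' \<noteq> \<one>"
      using conj_eq_one_iff[OF gc bc] that(6) by blast
    have ib': "inv ?b' \<in> A" "inv ?b' \<noteq> \<one>"
      using that(7) b'1 gc bc subgroup.m_inv_closed[OF A] by (auto simp: inv_eq_1_iff)
    let ?qs = "ps @ [(True, b)] @ inv_syllables ps @ [(True, inv ?b')]"
    have "inv_syllables ps \<noteq> []" "\<not> fst (hd (inv_syllables ps))" "\<not> fst (last (inv_syllables ps))"
      using that(2-4) by (auto simp: inv_syllables_def hd_rev last_rev last_map hd_map)
    then have "alternating A B ?qs"
      using that ib' alternating_inv_syllables[OF A B that(1)]
      by (simp add: alternating_append del: append_Cons)
    moreover have "syllable_prod (inv_syllables ps @ [(True, inv ?b')]) = inv ?g \<otimes> inv ?b'"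
      using car car' AC[OF ib'(1)] by (simp add: syllable_prod_append syllable_prod_inv_syllables)
    then have "syllable_prod ?qs = ?g \<otimes> (b \<otimes> (inv ?g \<otimes> inv ?b'))"
      using car car' bc AC[OF ib'(1)] by (subst syllable_prod_append) auto
    then have "syllable_prod ?qs = ?b' \<otimes> inv ?b'"
      using gc bc AC[OF ib'(1)] by (simp only: m_assoc inv_closed m_closed)
    then have "syllable_prod ?qs = \<one>" using gc bc by simp
    ultimately show False using internal_free_productD(4)[OF fp] by blast
  qed
  have start: "syllable_prod ps \<in> A" if "alternating A B ps" "ps = [] \<or> \<not> fst (last ps)"
      "b \<in> A" "b \<noteq> \<one>" "syllable_prod ps \<otimes> b \<otimes> inv (syllable_prod ps) \<in> A" for ps b
  proof (cases "ps = [] \<or> \<not> fst (hd ps)")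
    case True
    then show ?thesis using ends that subgroup.one_closed[OF A] by (cases "ps = []") auto
  next
    case False
    then obtain c qs where ps: "ps = (True, c) # qs" by (cases ps) (auto simp: prod_eq_iff)
    then have qs: "alternating A B qs" "c \<in> A" "qs \<noteq> []" "\<not> fst (hd qs)" "\<not> fst (last qs)"
      using that(1,2) by (auto simp: alternating_Cons[of _ _ _ qs] split: if_splits)
    let ?q = "syllable_prod qs"
    have cc: "c \<in> carrier G" "?q \<in> carrier G" "b \<in> carrier G"
      using AC[OF qs(2)] AC[OF that(3)] syllable_prod_closed[OF alternating_carrier[OF A B qs(1)]]
      by auto
    \<comment> \<open>The leading syllable \<open>c\<close> is moved to the other side of the
      conjugation equation, leaving the conjugate by \<open>qs\<close> in \<open>A\<close>; this
      contradicts \<open>ends\<close>.\<close>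
    have "inv c \<otimes> (syllable_prod ps \<otimes> b \<otimes> inv (syllable_prod ps)) \<otimes> c \<in> A"
      using that(5) qs(2) by (simp add: subgroup.m_inv_closed[OF A] subgroup.m_closed[OF A])
    moreover have "inv c \<otimes> (syllable_prod ps \<otimes> b \<otimes> inv (syllable_prod ps)) \<otimes> c = ?q \<otimes> b \<otimes> inv ?q"
      using cc conj_mult[of c ?q b] inv_conj_conj[of c "?q \<otimes> b \<otimes> inv ?q"] by (simp add: ps)
    ultimately show ?thesis using ends[OF qs(1,3,5,4) that(3,4)] by simp
  qed
  obtain ps where ps: "alternating A B ps" "syllable_prod ps = g"
    using generate_normal_form[OF A B] g internal_free_productD(3)[OF fp] by blast
  show ?thesis
  proof (cases "ps = [] \<or> \<not> fst (last ps)")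
    case True
    then show ?thesis using start[OF ps(1) True a] a' ps(2) by simp
  next
    case False
    then obtain c qs where pq: "ps = qs @ [(True, c)]"
      by (cases ps rule: rev_cases) (auto simp: prod_eq_iff)
    then have qs: "alternating A B qs" "c \<in> A" "qs = [] \<or> \<not> fst (last qs)"
      using ps(1) by (auto simp: alternating_append)
    let ?q = "syllable_prod qs"
    have cc: "c \<in> carrier G" "?q \<in> carrier G" "a \<in> carrier G"
      using AC[OF qs(2)] AC[OF a(1)] syllable_prod_closed[OF alternating_carrier[OF A B qs(1)]]
      by auto
    have gq: "g = ?q \<otimes> c"
      using ps(2) cc alternating_carrier[OF A B qs(1)] by (simp add: pq syllable_prod_append)
    \<comment> \<open>The trailing syllable \<open>c\<close> is absorbed into the conjugated
      element, which stays nontrivial and in \<open>A\<close>.\<close>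
    have "g \<otimes> a \<otimes> inv g = ?q \<otimes> (c \<otimes> a \<otimes> inv c) \<otimes> inv ?q"
      using conj_mult[of ?q c a] cc by (simp add: gq)
    moreover have "c \<otimes> a \<otimes> inv c \<in> A"
      using qs a subgroup.m_inv_closed[OF A] subgroup.m_closed[OF A] by simp
    moreover have "c \<otimes> a \<otimes> inv c \<noteq> \<one>"
      using conj_eq_one_iff cc a by blast
    ultimately have "?q \<in> A" using start[OF qs(1,3)] a' by simp
    then show ?thesis using gq qs(2) subgroup.m_closed[OF A] by simp
  qed
qed

lemma malnormal_free_factor:
  assumes "malnormal G H" "internal_free_product G A B H"
  shows "malnormal G A"
  unfolding malnormal_iff
proof (intro conjI ballI impI)
  show A: "subgroup A G" by (rule internal_free_productD(1)[OF assms(2)])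
  fix g h assume *: "g \<in> carrier G" "h \<in> A" "h \<noteq> \<one>" "g \<otimes> h \<otimes> inv g \<in> A"
  have "h \<in> H" "g \<otimes> h \<otimes> inv g \<in> H"
    using *(2,4) internal_free_product_subset(1)[OF assms(2)] by (simp_all add: subsetD)
  then have "g \<in> H" by (intro malnormalD[OF assms(1) *(1) _ *(3)])
  then show "g \<in> A" using free_factor_malnormal[OF assms(2) _ *(2-4)] by blast
qed

text \<open>A decomposition \<open>K' * C\<close> of the closure with \<open>K\<close> inside
  \<open>K'\<close> would make \<open>K'\<close> a malnormal subgroup containing \<open>K\<close>.
  Then \<open>K'\<close> contains the whole closure, in particular \<open>C\<close>, although free
  factors meet trivially.\<close>

lemma algebraic_extension_mal:
  assumes K: "subgroup K G" shows "algebraic_extension G K (mal G K)"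
proof -
  note M = malnormal_mal[OF subgroup.subset[OF K]]
  have "\<not> free_extension G K (mal G K)"
  proof
    assume "free_extension G K (mal G K)"
    then obtain K' C where KC: "subgroup C G" "C \<noteq> {\<one>}" "K \<subseteq> K'"
      "internal_free_product G K' C (mal G K)"
      unfolding free_extension_def by blast
    have "mal G K \<subseteq> K'"
      using mal_subset[OF malnormal_free_factor[OF M KC(4)] KC(3)] .
    moreover have "C \<subseteq> mal G K" by (rule internal_free_product_subset(2)[OF KC(4)])
    ultimately have CK: "C \<subseteq> K'" by blast
    obtain c where c: "c \<in> C" "c \<noteq> \<one>"
      using KC(1,2) subgroup.one_closed[OF KC(1)] by blast
    have K': "subgroup K' G" by (rule internal_free_productD(1)[OF KC(4)])
    have "inv c \<in> K'" "inv c \<noteq> \<one>" "c \<in> carrier G"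
      using c CK subgroup.m_inv_closed[OF K'] subgroup.mem_carrier[OF K'] by (auto simp: inv_eq_1_iff)
    \<comment> \<open>The same element is taken once from \<open>C\<close> and once, inverted, from
      \<open>K'\<close>: an alternating product that collapses.\<close>
    then have "alternating K' C [(False, c), (True, inv c)]"
      using c by (simp add: alternating_Cons[of _ _ _ "[_]"])
    moreover have "syllable_prod [(False, c), (True, inv c)] = \<one>"
      using \<open>c \<in> carrier G\<close> by simp
    ultimately show False using internal_free_productD(4)[OF KC(4)] by blast
  qed
  then show ?thesis
    unfolding algebraic_extension_def using K malnormal_subgroup[OF M] subset_mal by blast
qed

end

section \<open>Folded quotients of finite subtrees of the Cayley tree\<close>

lemma (in group) inv_cancel:
  assumes "x \<in> carrier G" "y \<in> carrier G"
  shows "x \<otimes> (inv x \<otimes> y) = y" "inv x \<otimes> (x \<otimes> y) = y"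
  using assms by (simp_all add: m_assoc[symmetric])

definition inv_word :: "'a word \<Rightarrow> 'a word" where
  "inv_word w = rev (map inv_letter w)"

lemma inv_word_simps [simp]:
  "inv_word [] = []" "inv_word (a # w) = inv_word w @ [inv_letter a]"
  "inv_word w = [] \<longleftrightarrow> w = []"
  by (simp_all add: inv_word_def)

lemma inv_letter_eq_iff [simp]: "inv_letter a = inv_letter b \<longleftrightarrow> a = b"
  by (metis inv_letter_inv_letter)

lemma inv_letter_mem_iff [simp]: "inv_letter a \<in> X \<times> UNIV \<longleftrightarrow> a \<in> X \<times> UNIV"
  by (cases a) (auto simp: inv_letter_def)

lemma reduced_append:
  "reduced (u @ w) \<longleftrightarrow> reduced u \<and> reduced w \<and> (u = [] \<or> w = [] \<or> hd w \<noteq> inv_letter (last u))"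
  by (auto simp: reduced_def successively_append_iff)

lemma reduced_Nil [simp]: "reduced []"
  by (simp add: reduced_def)

lemma reduced_singleton [simp]: "reduced [a]"
  by (simp add: reduced_def)

lemma reduced_Cons: "reduced (a # w) \<longleftrightarrow> reduced w \<and> (w = [] \<or> hd w \<noteq> inv_letter a)"
  using reduced_append[of "[a]" w] by simp

lemma reduced_inv_word: "reduced w \<Longrightarrow> reduced (inv_word w)"
proof (induction w)
  case (Cons a w)
  then show ?case
    by (cases w) (auto simp: reduced_append reduced_Cons)
qed simp

lemma cancel_Cons_reduced: "reduced (a # w) \<Longrightarrow> cancel_Cons a w = a # w"
  by (cases w) (auto simp: reduced_Cons)

locale free_group_on =
  fixes X :: "'a set"
begin

sublocale group "free_group X"
  by (rule group_free_group)

abbreviation free_mult (infixl \<open>\<cdot>\<close> 70) where "u \<cdot> v \<equiv> u \<otimes>\<^bsub>free_group X\<^esub> v"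
abbreviation free_inv where "free_inv u \<equiv> inv\<^bsub>free_group X\<^esub> u"
abbreviation F where "F \<equiv> carrier (free_group X)"

lemma one_def [simp]: "\<one>\<^bsub>free_group X\<^esub> = []"
  by (simp add: free_group_def)

lemma Nil_mult [simp]:
  "w \<in> F \<Longrightarrow> [] \<cdot> w = w" "w \<in> F \<Longrightarrow> w \<cdot> [] = w" "free_inv [] = []"
  using l_one[of w] r_one[of w] inv_one by simp_all

lemma F_iff: "w \<in> F \<longleftrightarrow> set w \<subseteq> X \<times> UNIV \<and> reduced w"
  by (simp add: free_group_def)

lemma Nil_F [simp]: "[] \<in> F"
  by (simp add: F_iff)

lemma mult_foldr: "v \<in> F \<Longrightarrow> u \<cdot> v = foldr cancel_Cons u v"
  by (simp add: free_group_def reduce_append)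

lemma mult_append: "reduced (u @ v) \<Longrightarrow> u \<cdot> v = u @ v"
  by (simp add: free_group_def reduce_reduced)

lemma singleton_F: "a \<in> X \<times> UNIV \<Longrightarrow> [a] \<in> F"
  by (simp add: F_iff)

lemma singleton_mult: "p \<in> F \<Longrightarrow> [a] \<cdot> p = cancel_Cons a p"
  by (simp add: mult_foldr)

lemma inv_word_F: "w \<in> F \<Longrightarrow> inv_word w \<in> F"
  by (auto simp: F_iff reduced_inv_word) (auto simp: inv_word_def inv_letter_def)

lemma free_inv_eq: "w \<in> F \<Longrightarrow> free_inv w = inv_word w"
proof (rule inv_equality)
  assume w: "w \<in> F"
  then show "inv_word w \<cdot> w = \<one>\<^bsub>free_group X\<^esub>"
    using foldr_inverse[of "[]" w] reduce_reduced[of w]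
    by (simp add: mult_foldr inv_word_def F_iff reduce_def)
qed (auto simp: inv_word_F)

lemma Cons_mult: "a # w \<in> F \<Longrightarrow> a # w = [a] \<cdot> w" "a # w \<in> F \<Longrightarrow> w \<in> F" "a # w \<in> F \<Longrightarrow> [a] \<in> F"
  by (auto simp: F_iff mult_append reduced_Cons)

lemma snoc_mult:
  "w @ [a] \<in> F \<Longrightarrow> w @ [a] = w \<cdot> [a]" "w @ [a] \<in> F \<Longrightarrow> w \<in> F" "w @ [a] \<in> F \<Longrightarrow> [a] \<in> F"
  by (auto simp: F_iff mult_append reduced_append)

definition cyclically_reduced :: "'a word \<Rightarrow> bool" where
  "cyclically_reduced k \<longleftrightarrow> k \<noteq> [] \<and> k \<in> F \<and> reduced (k @ k)"

lemma cyclically_reduced_rotate: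
  "cyclically_reduced (a # w) \<longleftrightarrow> cyclically_reduced (w @ [a])"
  by (cases "w = []") (auto simp: cyclically_reduced_def F_iff reduced_Cons reduced_append)

text \<open>If \<open>h h\<close> is not reduced, the last letter of \<open>h\<close> cancels its
  first, so \<open>h\<close> is a conjugate by that letter of a shorter word. This word is nonempty
  because a letter next to its inverse would not be reduced.\<close>

lemma ex_cyclically_reduced_conj:
  assumes "h \<in> F" "h \<noteq> []"
  shows "\<exists>x k. x \<in> F \<and> cyclically_reduced k \<and> h = free_inv x \<cdot> k \<cdot> x"
  using assms
proof (induction h rule: length_induct)
  case (1 h)
  show ?case
  proof (cases "reduced (h @ h)")
    case True
    then show ?thesis using 1 by (intro exI[of _ "[]"] exI[of _ h]) (auto simp: cyclically_reduced_def)
  next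
    case False
    then have last: "hd h = inv_letter (last h)"
      using 1 by (auto simp: reduced_append F_iff)
    obtain a w where w: "h = w @ [a]"
      using 1 by (cases h rule: rev_cases) auto
    have "w \<noteq> []" using last w by auto
    then obtain m where m: "h = inv_letter a # m @ [a]"
      using last w by (cases w) auto
    have mF: "m @ [a] \<in> F" "m \<in> F" "[a] \<in> F"
      using 1 m Cons_mult(2) snoc_mult by metis+
    have "m \<noteq> []" using 1 m by (auto simp: F_iff reduced_Cons)
    moreover have "length m < length h" using m by simp
    ultimately obtain x k where
      xk: "x \<in> F" "cyclically_reduced k" "m = free_inv x \<cdot> k \<cdot> x"
      using 1(1) mF(2) by blast
    have kF: "k \<in> F" using xk by (simp add: cyclically_reduced_def)
    have "h = free_inv [a] \<cdot> (m \<cdot> [a])"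
      using 1(2) Cons_mult(1) snoc_mult(1)[OF mF(1)] m mF by (simp add: free_inv_eq)
    also have "\<dots> = free_inv (x \<cdot> [a]) \<cdot> k \<cdot> (x \<cdot> [a])"
      using xk mF kF by (simp add: inv_mult_group m_assoc)
    finally show ?thesis using xk mF m_closed by blast
  qed
qed

end

section \<open>Reading words in a folded quotient of a subtree\<close>

locale folded_tree = free_group_on X for X :: "'a set" +
  fixes V :: "'a word set" and E :: "('a word \<times> 'a word) set"
  assumes V_subset: "V \<subseteq> F"
    and Nil_V: "[] \<in> V"
    and suffix_V: "a # p \<in> V \<Longrightarrow> p \<in> V"
    and equiv_E: "equiv V E"
    and fold_E: "a \<in> X \<times> UNIV \<Longrightarrow> (p, q) \<in> E \<Longrightarrow> cancel_Cons a p \<in> V \<Longrightarrow> cancel_Cons a q \<in> V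
      \<Longrightarrow> (cancel_Cons a p, cancel_Cons a q) \<in> E"
begin

lemma V_F: "p \<in> V \<Longrightarrow> p \<in> F"
  using V_subset by blast

lemma E_V: "(p, q) \<in> E \<Longrightarrow> p \<in> V" "(p, q) \<in> E \<Longrightarrow> q \<in> V"
  using equiv_E by (auto dest: equiv_type)

lemma E_refl: "p \<in> V \<Longrightarrow> (p, p) \<in> E"
  using equiv_E by (auto simp: equiv_def refl_on_def)

lemma E_sym: "(p, q) \<in> E \<Longrightarrow> (q, p) \<in> E"
  using equiv_E by (auto simp: equiv_def dest: symD)

lemma E_trans: "(p, q) \<in> E \<Longrightarrow> (q, r) \<in> E \<Longrightarrow> (p, r) \<in> E"
  using equiv_E by (auto simp: equiv_def dest: transD)

text \<open>Either \<open>a\<close> is prepended, or its inverse was the first letter of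
  \<open>p\<close>; one of the two vertices therefore shows that the label is over
  \<open>X\<close>.\<close>

lemma edge_letter: "p \<in> V \<Longrightarrow> cancel_Cons a p \<in> V \<Longrightarrow> a \<in> X \<times> UNIV"
  using V_F[of p] V_F[of "cancel_Cons a p"] inv_letter_mem_iff[of a X]
  by (cases p) (auto simp: F_iff split: if_splits)

lemma edge_inv: "p \<in> V \<Longrightarrow> cancel_Cons (inv_letter a) (cancel_Cons a p) = p"
  using cancel_Cons_inv[of p "inv_letter a"] V_F[of p] by (simp add: F_iff)

lemma edge_fold:
  "(p, q) \<in> E \<Longrightarrow> cancel_Cons a p \<in> V \<Longrightarrow> cancel_Cons a q \<in> V
    \<Longrightarrow> (cancel_Cons a p, cancel_Cons a q) \<in> E"
  using fold_E edge_letter E_V(1) by blast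

text \<open>Letters come with their inverses, so closure under folding in one direction, applied to
  the inverse letter, also gives the other direction.\<close>

lemma edge_unfold:
  assumes "(cancel_Cons a p, cancel_Cons a q) \<in> E" "p \<in> V" "q \<in> V"
  shows "(p, q) \<in> E"
  using edge_fold[OF assms(1), of "inv_letter a"] assms by (simp add: edge_inv)

text \<open>Paths in the quotient graph, with the last letter of the word read first. Each edge may
  start at any representative of the current class, since the given representative need not have an
  \<open>a\<close>-edge inside \<open>V\<close>.\<close>

primrec reads :: "'a word \<Rightarrow> 'a word \<Rightarrow> 'a word \<Rightarrow> bool" where
  "reads [] p r \<longleftrightarrow> (p, r) \<in> E"
| "reads (a # w) p r \<longleftrightarrow> (\<exists>q. reads w p q \<and> cancel_Cons a q \<in> V \<and> (cancel_Cons a q, r) \<in> E)"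

lemma reads_V: "reads w p r \<Longrightarrow> p \<in> V \<and> r \<in> V"
  by (induction w arbitrary: r) (auto dest: E_V)

lemma reads_right: "reads w p r \<Longrightarrow> (r, r') \<in> E \<Longrightarrow> reads w p r'"
  by (cases w) (auto intro: E_trans)

lemma reads_left: "reads w p r \<Longrightarrow> (p', p) \<in> E \<Longrightarrow> reads w p' r"
  by (induction w arbitrary: r) (auto intro: E_trans)

lemma reads_append: "reads (u @ w) p r \<longleftrightarrow> (\<exists>q. reads w p q \<and> reads u q r)"
proof (induction u arbitrary: r)
  case Nil
  then show ?case using reads_right E_refl reads_V by (metis append_Nil reads.simps(1))
qed auto

lemma reads_det: "reads w p r \<Longrightarrow> reads w p' r' \<Longrightarrow> (p, p') \<in> E \<Longrightarrow> (r, r') \<in> E"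
proof (induction w arbitrary: r r')
  case Nil
  then show ?case by (auto intro: E_trans E_sym)
next
  case (Cons a w)
  then obtain q q' where q: "(cancel_Cons a q, r) \<in> E" "(cancel_Cons a q', r') \<in> E" "(q, q') \<in> E"
    by auto
  then have "(cancel_Cons a q, cancel_Cons a q') \<in> E"
    using edge_fold E_V(1) by blast
  then show ?case using q(1,2) E_trans E_sym by blast
qed

lemma reads_singleton:
  "reads [a] p r \<longleftrightarrow> (\<exists>q. (p, q) \<in> E \<and> cancel_Cons a q \<in> V \<and> (cancel_Cons a q, r) \<in> E)"
  by simp

lemma reads_singleton_inv:
  assumes "reads [a] p r" shows "reads [inv_letter a] r p"
proof -
  obtain q where q: "(p, q) \<in> E" "cancel_Cons a q \<in> V" "(cancel_Cons a q, r) \<in> E"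
    using assms by auto
  then have "cancel_Cons (inv_letter a) (cancel_Cons a q) = q"
    using edge_inv E_V(2) by blast
  then show ?thesis
    unfolding reads_singleton using q E_sym E_V(2) by metis
qed

lemma reads_inv: "reads w p r \<Longrightarrow> reads (inv_word w) r p"
proof (induction w arbitrary: r)
  case Nil
  then show ?case by (simp add: E_sym)
next
  case (Cons a w)
  obtain q where "reads w p q" "reads [a] q r"
    using Cons.prems reads_append[of "[a]" w] by auto
  then show ?case
    unfolding inv_word_simps reads_append using Cons.IH reads_singleton_inv by blast
qed

text \<open>Going along an edge and back returns to the same class by \<open>reads_det\<close>.
  Hence readability survives free reduction, which makes reading compatible with the product of the
  free group.\<close>

lemma reads_cancel:
  assumes "reads (a # inv_letter a # w) p r" shows "reads w p r"
proof -
  obtain q q' where q: "reads w p q" "reads [inv_letter a] q q'" "reads [a] q' r"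
    using assms reads_append[of "[a]" "inv_letter a # w"] reads_append[of "[inv_letter a]" w]
    unfolding append_Cons append_Nil by blast
  have "reads [a] q' q" using reads_singleton_inv[OF q(2)] by simp
  then have "(q, r) \<in> E" using q(3) reads_det E_refl reads_V by blast
  then show ?thesis using reads_right q(1) by blast
qed

lemma reads_cancel_Cons: "reads (a # w) p r \<Longrightarrow> reads (cancel_Cons a w) p r"
  by (cases "(a, w)" rule: cancel_Cons.cases) (auto dest: reads_cancel simp del: reads.simps)

lemma reads_foldr: "reads (u @ w) p r \<Longrightarrow> reads (foldr cancel_Cons u w) p r"
proof (induction u arbitrary: r)
  case (Cons a u)
  then have "reads (a # foldr cancel_Cons u w) p r" by auto
  then show ?case by (simp only: foldr.simps o_apply reads_cancel_Cons)
qed simp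

lemma reads_mult: "v \<in> F \<Longrightarrow> reads v p q \<Longrightarrow> reads u q r \<Longrightarrow> reads (u \<cdot> v) p r"
  unfolding mult_foldr by (rule reads_foldr) (auto simp: reads_append)

lemma reads_vertex: "p \<in> V \<Longrightarrow> reads p [] p"
proof (induction p)
  case Nil
  then show ?case by (simp add: E_refl)
next
  case (Cons a p)
  then have "cancel_Cons a p = a # p"
    using V_F[of "a # p"] by (simp add: F_iff cancel_Cons_reduced)
  then show ?case using Cons suffix_V E_refl by auto
qed

text \<open>The fundamental group of the quotient at the class of the empty word: each generator
  follows the tree path to \<open>q\<close>, passes to the equivalent vertex \<open>p\<close>, and
  returns along the tree.\<close>

definition loop_group :: "'a word set" where
  "loop_group = generate (free_group X) {free_inv p \<cdot> q | p q. (p, q) \<in> E}"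

lemma loop_gens_F: "{free_inv p \<cdot> q | p q. (p, q) \<in> E} \<subseteq> F"
  using E_V V_F by blast

lemma subgroup_loop_group: "subgroup loop_group (free_group X)"
  unfolding loop_group_def by (rule generate_is_subgroup[OF loop_gens_F])

lemma loop_group_F: "w \<in> loop_group \<Longrightarrow> w \<in> F"
  using subgroup.mem_carrier[OF subgroup_loop_group] .

lemma loop_group_gen: "(p, q) \<in> E \<Longrightarrow> free_inv p \<cdot> q \<in> loop_group"
  unfolding loop_group_def by (intro generate.incl) blast

lemma reads_gen:
  assumes "(p, q) \<in> E" shows "reads (free_inv p \<cdot> q) [] []"
proof -
  have "p \<in> V" "q \<in> V" using E_V assms by auto
  then have "reads q [] p" "reads (inv_word p) p []"
    using reads_vertex reads_right reads_inv assms E_sym by blast+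
  then show ?thesis
    using reads_mult \<open>p \<in> V\<close> \<open>q \<in> V\<close> by (simp add: free_inv_eq V_F)
qed

lemma reads_loop_group: "w \<in> loop_group \<Longrightarrow> reads w [] []"
  unfolding loop_group_def
proof (induction rule: generate.induct)
  case one
  then show ?case by (simp add: E_refl Nil_V)
next
  case (incl h)
  then show ?case using reads_gen by blast
next
  case (inv h)
  then have "h \<in> F" "reads h [] []" using reads_gen loop_gens_F by blast+
  then show ?case using reads_inv by (simp add: free_inv_eq)
next
  case (eng h1 h2)
  then show ?case using reads_mult generate_in_carrier[OF loop_gens_F] by blast
qed

text \<open>A path from \<open>q\<close> to \<open>r\<close> is closed up by the tree paths to its
  end points, so that the induction can run over paths that are not loops. Inserting
  \<open>s\<close> and its inverse at each intermediate vertex splits the closed path into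
  generators.\<close>

lemma reads_imp_loop_group:
  assumes "reads w q r" "w \<in> F" shows "free_inv r \<cdot> (w \<cdot> q) \<in> loop_group"
  using assms
proof (induction w arbitrary: r)
  case Nil
  then have "(r, q) \<in> E" "q \<in> F" using E_sym E_V V_F by auto
  then show ?case using loop_group_gen by simp
next
  case (Cons a w)
  then obtain s where s: "reads w q s" "cancel_Cons a s \<in> V" "(cancel_Cons a s, r) \<in> E" by auto
  note w = Cons_mult[OF Cons.prems(2)]
  have F: "s \<in> F" "q \<in> F" "r \<in> F" "cancel_Cons a s = [a] \<cdot> s"
    using reads_V[OF s(1)] V_F E_V(2)[OF s(3)] singleton_mult by auto
  have "free_inv s \<cdot> (w \<cdot> q) \<in> loop_group" using Cons.IH s(1) w by blast
  moreover have "free_inv r \<cdot> ([a] \<cdot> s) \<in> loop_group"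
    using loop_group_gen[OF E_sym[OF s(3)]] F by simp
  ultimately have "free_inv r \<cdot> ([a] \<cdot> s) \<cdot> (free_inv s \<cdot> (w \<cdot> q)) \<in> loop_group"
    by (rule subgroup.m_closed[OF subgroup_loop_group, rotated])
  also have "free_inv r \<cdot> ([a] \<cdot> s) \<cdot> (free_inv s \<cdot> (w \<cdot> q)) = free_inv r \<cdot> ([a] \<cdot> w \<cdot> q)"
    using F w by (simp add: m_assoc inv_cancel)
  finally show ?case using w(1) by simp
qed

text \<open>The word \<open>q\<close> is \<open>p\<close> times the loop
  \<open>p\<inverse> q\<close>, hence can be read from the root to \<open>p\<close>, and also to
  \<open>q\<close>; determinism identifies the two. So the relation is recovered from its loop
  group, and inclusions of subgroups turn into inclusions of relations.\<close>

lemma E_iff_loop_group: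
  assumes "p \<in> V" "q \<in> V"
  shows "(p, q) \<in> E \<longleftrightarrow> free_inv p \<cdot> q \<in> loop_group"
proof
  assume "free_inv p \<cdot> q \<in> loop_group"
  then have "reads (free_inv p \<cdot> q) [] []" by (rule reads_loop_group)
  then have "reads (p \<cdot> (free_inv p \<cdot> q)) [] p"
    using reads_mult reads_vertex assms V_F by blast
  then have "reads q [] p" using assms V_F by (simp add: inv_cancel)
  then show "(p, q) \<in> E" using reads_det reads_vertex E_refl Nil_V assms by blast
qed (rule loop_group_gen)

lemma reads_rotate:
  "reads (w @ [a]) p p \<Longrightarrow> \<exists>r. reads [a] p r \<and> reads (a # w) r r"
  using reads_append[of w "[a]"] reads_append[of "[a]" w] by auto

lemma reads_rotate':
  "reads (a # w) p p \<Longrightarrow> \<exists>r. reads [a] r p \<and> reads (w @ [a]) r r"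
  using reads_append[of w "[a]"] reads_append[of "[a]" w] by auto

text \<open>Membership of \<open>free_inv p \<cdot> x\<close> says that the vertex \<open>p\<close>
  represents the left coset of \<open>x\<close>. This is transported along an edge.\<close>

lemma loop_group_step:
  assumes "reads [a] p r" "free_inv p \<cdot> x \<in> loop_group" "x \<in> F" "[a] \<in> F"
  shows "free_inv r \<cdot> ([a] \<cdot> x) \<in> loop_group"
proof -
  have F: "p \<in> F" "r \<in> F" using reads_V[OF assms(1)] V_F by auto
  have "free_inv r \<cdot> ([a] \<cdot> p) \<cdot> (free_inv p \<cdot> x) \<in> loop_group"
    by (rule subgroup.m_closed[OF subgroup_loop_group reads_imp_loop_group[OF assms(1,4)] assms(2)])
  then show ?thesis using F assms by (simp add: m_assoc inv_cancel)
qed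

text \<open>A cyclically reduced loop of the coset graph lies in its core, hence is read on \<open>V\<close>.\<close>

lemma cyclically_reduced_reads:
  assumes "cyclically_reduced k" "x \<in> F" "free_inv x \<cdot> k \<cdot> x \<in> loop_group"
  shows "\<exists>p. reads k p p \<and> free_inv p \<cdot> x \<in> loop_group"
  using assms
proof (induction x arbitrary: k)
  case Nil
  then have "k \<in> F" by (simp add: cyclically_reduced_def)
  then have "reads k [] []" using Nil reads_loop_group by simp
  then show ?case using subgroup.one_closed[OF subgroup_loop_group] by auto
next
  case (Cons a x)
  note x = Cons_mult[OF Cons.prems(2)]
  have kF: "k \<in> F" "k \<noteq> []" using Cons.prems by (auto simp: cyclically_reduced_def)
  have mult: "free_inv (a # x) = free_inv x \<cdot> free_inv [a]"
    using x by (simp add: inv_mult_group)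
  \<comment> \<open>Either the conjugate is reduced as written, or a letter cancels at one end of
    \<open>k\<close>. In the latter cases rotating \<open>k\<close> by that letter shortens the
    conjugator to \<open>x\<close>, so the induction has to be general in \<open>k\<close>.\<close>
  consider (red) "reduced (inv_word (a # x) @ k @ a # x)"
    | (last) k0 where "k = k0 @ [inv_letter a]" | (first) k0 where "k = a # k0"
  proof (cases "last k = inv_letter a \<or> hd k = a")
    case True
    then show ?thesis using kF(2) that(2,3) by (metis append_butlast_last_id list.collapse)
  next
    case False
    have "a \<noteq> inv_letter (last k)" using False by auto
    then have "reduced (k @ a # x)"
      using Cons.prems(2) kF by (simp add: reduced_append F_iff)
    moreover have "reduced (inv_word (a # x))"
      using inv_word_F[OF Cons.prems(2)] by (simp only: F_iff)
    ultimately have "reduced (inv_word (a # x) @ (k @ a # x))"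
      unfolding reduced_append[of "inv_word (a # x)"] using False kF(2) by simp
    then show ?thesis by (rule that(1))
  qed
  then show ?case
  proof cases
    case red
    have "reduced (k @ a # x)"
      using red unfolding reduced_append[of "inv_word (a # x)"] by blast
    then have kx: "k \<cdot> (a # x) = k @ a # x" by (rule mult_append)
    have "free_inv (a # x) \<cdot> (k \<cdot> (a # x)) = inv_word (a # x) @ k @ a # x"
      using mult_append[OF red] kx by (simp add: free_inv_eq[OF Cons.prems(2)])
    then have "reads (inv_word (a # x) @ k @ (a # x)) [] []"
      using reads_loop_group[OF Cons.prems(3)] kF Cons.prems(2) by (simp add: m_assoc)
    \<comment> \<open>The loop runs out along the conjugator to \<open>p\<close>, reads
      \<open>k\<close>, and returns from \<open>p'\<close>. Reversing the return path shows that
      both vertices are reached by the same word.\<close>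
    then obtain p p' where p: "reads (a # x) [] p" "reads k p p'" "reads (inv_word (a # x)) p' []"
      unfolding reads_append by blast
    have "inv_word (inv_word (a # x)) = a # x"
      by (simp add: inv_word_def rev_map o_def)
    then have "reads (a # x) [] p'" using reads_inv[OF p(3)] by simp
    then have "(p', p) \<in> E" using p(1) reads_det E_refl Nil_V by blast
    then have "reads k p p" using p(2) reads_right by blast
    moreover have "free_inv p \<cdot> (a # x) \<in> loop_group"
      using reads_imp_loop_group[OF p(1) Cons.prems(2)] Cons.prems(2) by simp
    ultimately show ?thesis by blast
  next
    case last
    note k0 = snoc_mult[OF kF(1)[unfolded last]]
    have ia: "[inv_letter a] = free_inv [a]" using x(3) by (simp add: free_inv_eq)
    have cyc: "cyclically_reduced (inv_letter a # k0)"
      using Cons.prems(1) last cyclically_reduced_rotate by simp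
    then have "inv_letter a # k0 \<in> F" by (simp add: cyclically_reduced_def)
    then have k': "inv_letter a # k0 = free_inv [a] \<cdot> k0" "k = k0 \<cdot> free_inv [a]"
      using Cons_mult(1)[of "inv_letter a" k0] k0(1) last unfolding ia by simp_all
    have "free_inv x \<cdot> (inv_letter a # k0) \<cdot> x = free_inv (a # x) \<cdot> k \<cdot> (a # x)"
      unfolding mult k' unfolding x(1) using x k0(2) by (simp add: m_assoc inv_cancel)
    then obtain p where p: "reads (inv_letter a # k0) p p" "free_inv p \<cdot> x \<in> loop_group"
      using Cons.IH[OF cyc x(2)] Cons.prems(3) by auto
    obtain r where r: "reads [inv_letter a] r p" "reads (k0 @ [inv_letter a]) r r"
      using reads_rotate'[OF p(1)] by blast
    have "reads [a] p r" using reads_singleton_inv[OF r(1)] by simp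
    then show ?thesis
      using r(2) loop_group_step[OF _ p(2) x(2,3)] x(1) last by auto
  next
    case first
    note k0 = Cons_mult[OF kF(1)[unfolded first]]
    have cyc: "cyclically_reduced (k0 @ [a])"
      using Cons.prems(1) first cyclically_reduced_rotate by simp
    then have "k0 @ [a] \<in> F" by (simp add: cyclically_reduced_def)
    note k' = snoc_mult(1)[OF this]
    have "free_inv x \<cdot> (k0 @ [a]) \<cdot> x = free_inv (a # x) \<cdot> k \<cdot> (a # x)"
      unfolding mult k' unfolding first k0(1) x(1) using x k0(2) by (simp add: m_assoc inv_cancel)
    then obtain p where p: "reads (k0 @ [a]) p p" "free_inv p \<cdot> x \<in> loop_group"
      using Cons.IH[OF cyc x(2)] Cons.prems(3) by auto
    obtain r where r: "reads [a] p r" "reads (a # k0) r r"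
      using reads_rotate[OF p(1)] by blast
    then show ?thesis
      using loop_group_step[OF r(1) p(2) x(2,3)] x(1) first by auto
  qed
qed

end

text \<open>A set \<open>T\<close> of pairs of inequivalent, equally labelled edges in which every pair can be
  continued without backtracking encodes an infinite reduced path off the diagonal of the fibre
  product of the folded graph with itself.\<close>

definition (in free_group_on) self_continuing ::
    "'a word set \<Rightarrow> ('a word \<times> 'a word) set \<Rightarrow> (('a \<times> bool) \<times> 'a word \<times> 'a word) set \<Rightarrow> bool" where
  "self_continuing V E T \<longleftrightarrow> (\<forall>(a, p, q)\<in>T.
     a \<in> X \<times> UNIV \<and> p \<in> V \<and> q \<in> V \<and> cancel_Cons a p \<in> V \<and> cancel_Cons a q \<in> V \<and> (p, q) \<notin> E \<and>
     (\<exists>(b, p', q')\<in>T. b \<noteq> inv_letter a \<and> (cancel_Cons a p, p') \<in> E \<and> (cancel_Cons a q, q') \<in> E))"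

section \<open>Malnormality of the loop group\<close>

locale malnormal_tree = folded_tree +
  assumes no_self_continuing: "self_continuing V E T \<Longrightarrow> T = {}"
begin

text \<open>Two inequivalent vertices with the common loop \<open>k\<close> give a closed path off
  the diagonal of the fibre product. Being cyclically reduced, \<open>k\<close> can be traversed
  forever without backtracking, so the edge pairs along it continue one another.\<close>

lemma cyclic_loops_equivalent:
  assumes k: "cyclically_reduced k" and p: "reads k p p" and q: "reads k q q"
  shows "(p, q) \<in> E"
proof (rule ccontr)
  assume pq: "(p, q) \<notin> E"
  \<comment> \<open>The set is closed under rotating the loop: its members are the pairs of edges
    that open some common cyclically reduced loop. The opening letter \<open>a\<close> stands last
    because reading goes from the right.\<close>
  let ?T = "{(a, p, q). p \<in> V \<and> q \<in> V \<and> cancel_Cons a p \<in> V \<and> cancel_Cons a q \<in> V \<and> (p, q) \<notin> E \<and>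
    (\<exists>w. cyclically_reduced (w @ [a]) \<and> reads (w @ [a]) p p \<and> reads (w @ [a]) q q)}"
  \<comment> \<open>The vertices are replaced by equivalent ones at which the opening edge exists
    inside \<open>V\<close>.\<close>
  have start: "\<exists>p' q'. (p, p') \<in> E \<and> (q, q') \<in> E \<and> (b, p', q') \<in> ?T"
    if wb: "cyclically_reduced (w @ [b])" "reads (w @ [b]) p p" "reads (w @ [b]) q q" "(p, q) \<notin> E"
    for w b p q
  proof -
    obtain p' where p': "(p, p') \<in> E" "cancel_Cons b p' \<in> V"
      using wb(2) reads_append[of w "[b]"] by auto
    obtain q' where q': "(q, q') \<in> E" "cancel_Cons b q' \<in> V"
      using wb(3) reads_append[of w "[b]"] by auto
    have "reads (w @ [b]) p' p'" "reads (w @ [b]) q' q'"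
      using wb p'(1) q'(1) by (meson reads_left reads_right E_sym)+
    moreover have "(p', q') \<notin> E" using p'(1) q'(1) wb(4) by (meson E_trans E_sym)
    ultimately show ?thesis using p' q' wb(1) E_V(2) by blast
  qed
  have "self_continuing V E ?T"
    unfolding self_continuing_def
  proof (rule ballI, clarify)
    fix a p q w
    assume *: "p \<in> V" "q \<in> V" "cancel_Cons a p \<in> V" "cancel_Cons a q \<in> V" "(p, q) \<notin> E"
      "cyclically_reduced (w @ [a])" "reads (w @ [a]) p p" "reads (w @ [a]) q q"
    have step: "reads (a # w) (cancel_Cons a s) (cancel_Cons a s)"
      if s: "s \<in> V" "cancel_Cons a s \<in> V" "reads (w @ [a]) s s" for s
    proof -
      obtain r where r: "reads [a] s r" "reads (a # w) r r" using reads_rotate[OF s(3)] by blast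
      have "reads [a] s (cancel_Cons a s)" unfolding reads_singleton using s E_refl by blast
      then have "(r, cancel_Cons a s) \<in> E" using r(1) reads_det E_refl s(1) by blast
      then show ?thesis using r(2) by (meson reads_left reads_right E_sym)
    qed
    obtain w' b where w': "a # w = w' @ [b]" by (metis rev_exhaust list.distinct(1))
    have "cyclically_reduced (w' @ [b])"
      using *(6) cyclically_reduced_rotate[of a w] w' by simp
    moreover have "reads (w' @ [b]) (cancel_Cons a p) (cancel_Cons a p)"
      "reads (w' @ [b]) (cancel_Cons a q) (cancel_Cons a q)"
      using step[OF *(1,3,7)] step[OF *(2,4,8)] unfolding w' by blast+
    moreover have "(cancel_Cons a p, cancel_Cons a q) \<notin> E" using *(1,2,5) edge_unfold by blast
    ultimately obtain p' q' where pq': "(cancel_Cons a p, p') \<in> E" "(cancel_Cons a q, q') \<in> E"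
      "(b, p', q') \<in> ?T"
      using start by blast
    \<comment> \<open>The letter read after \<open>a\<close> is the last one of \<open>w\<close>, or
      \<open>a\<close> itself if \<open>w\<close> is empty.\<close>
    have "b \<noteq> inv_letter a"
    proof (cases w rule: rev_cases)
      case Nil
      then show ?thesis using w' by simp
    next
      case (snoc u c)
      then have "b = c" using w' by (simp flip: append_Cons)
      moreover have "reduced (w @ [a])" using *(6) by (simp add: cyclically_reduced_def F_iff)
      then have "a \<noteq> inv_letter c" using snoc by (simp add: reduced_append reduced_Cons)
      ultimately show ?thesis by auto
    qed
    then show "a \<in> X \<times> UNIV \<and> p \<in> V \<and> q \<in> V \<and> cancel_Cons a p \<in> V \<and> cancel_Cons a q \<in> V \<and>
      (p, q) \<notin> E \<and>
      (\<exists>(b, p', q')\<in>?T. b \<noteq> inv_letter a \<and> (cancel_Cons a p, p') \<in> E \<and> (cancel_Cons a q, q') \<in> E)"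
      using * pq' edge_letter by blast
  qed
  then have "?T = {}" by (rule no_self_continuing)
  moreover obtain w b where w: "k = w @ [b]"
    using k by (cases k rule: rev_cases) (auto simp: cyclically_reduced_def)
  obtain p' q' where "(b, p', q') \<in> ?T"
    using start[OF k[unfolded w] p[unfolded w] q[unfolded w] pq] by blast
  ultimately show False by blast
qed

text \<open>Both \<open>h\<close> and its conjugate by \<open>g\<close> are conjugates of one
  cyclically reduced word \<open>k\<close>, by \<open>x\<close> and by \<open>x g\<inverse>\<close>.
  Hence \<open>k\<close> labels loops at vertices representing these two cosets. Those vertices are
  equivalent, so the cosets agree and \<open>g\<close> lies in the loop group.\<close>

lemma malnormal_loop_group: "malnormal (free_group X) loop_group"
  unfolding malnormal_iff
proof (intro conjI ballI impI)
  fix g h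
  assume g: "g \<in> F" and h: "h \<in> loop_group" "h \<noteq> \<one>\<^bsub>free_group X\<^esub>"
    and gh: "g \<cdot> h \<cdot> free_inv g \<in> loop_group"
  obtain x k where xk: "x \<in> F" "cyclically_reduced k" "h = free_inv x \<cdot> k \<cdot> x"
    using ex_cyclically_reduced_conj[OF loop_group_F[OF h(1)]] h(2) by auto
  have kF: "k \<in> F" using xk by (simp add: cyclically_reduced_def)
  let ?y = "x \<cdot> free_inv g"
  have y: "?y \<in> F" using xk g by simp
  have "free_inv ?y \<cdot> k \<cdot> ?y \<in> loop_group"
    using gh xk kF g by (simp add: inv_mult_group m_assoc)
  then obtain q where q: "reads k q q" "free_inv q \<cdot> ?y \<in> loop_group"
    using cyclically_reduced_reads[OF xk(2) y] by blast
  obtain p where p: "reads k p p" "free_inv p \<cdot> x \<in> loop_group"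
    using cyclically_reduced_reads[OF xk(2,1)] xk(3) h(1) by blast
  have pq: "free_inv p \<cdot> q \<in> loop_group"
    using cyclic_loops_equivalent[OF xk(2) p(1) q(1)] by (rule loop_group_gen)
  have F: "p \<in> F" "q \<in> F" using reads_V p(1) q(1) V_F by blast+
  have "free_inv (free_inv p \<cdot> x) \<cdot> (free_inv p \<cdot> q \<cdot> (free_inv q \<cdot> ?y)) \<in> loop_group"
    using p(2) q(2) pq by (simp only: subgroup.m_closed[OF subgroup_loop_group]
        subgroup.m_inv_closed[OF subgroup_loop_group])
  then have "free_inv g \<in> loop_group"
    using F xk(1) g by (simp add: inv_mult_group m_assoc inv_cancel)
  then have "free_inv (free_inv g) \<in> loop_group"
    by (rule subgroup.m_inv_closed[OF subgroup_loop_group])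
  then show "g \<in> loop_group" using g by simp
qed (rule subgroup_loop_group)

end

section \<open>The coset relation of a malnormal subgroup\<close>

context free_group_on
begin

definition coset_relation :: "'a word set \<Rightarrow> 'a word set \<Rightarrow> ('a word \<times> 'a word) set" where
  "coset_relation V M = {(p, q). p \<in> V \<and> q \<in> V \<and> free_inv p \<cdot> q \<in> M}"

text \<open>Equivalence and folding hold because left multiplication permutes left cosets. For the
  remaining condition, continuations inside a finite set must repeat, and the word between two
  visits labels loops at two distinct cosets, against malnormality.\<close>

lemma malnormal_tree_coset_relation:
  assumes "finite X" and V: "finite V" "V \<subseteq> F" "[] \<in> V" "\<And>a p. a # p \<in> V \<Longrightarrow> p \<in> V"
    and M: "malnormal (free_group X) M"
  shows "malnormal_tree X V (coset_relation V M)"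
proof
  note SM = malnormal_subgroup[OF M]
  note MF = subgroup.mem_carrier[OF SM] and M_mult = subgroup.m_closed[OF SM]
    and M_inv = subgroup.m_inv_closed[OF SM]
  let ?E = "coset_relation V M"
  have VF: "p \<in> V \<Longrightarrow> p \<in> F" for p using V(2) by blast
  show "V \<subseteq> F" "[] \<in> V" by fact+
  show "p \<in> V" if "a # p \<in> V" for a p using V(4) that .
  show "equiv V ?E"
  proof (rule equivI)
    show "?E \<subseteq> V \<times> V" by (auto simp: coset_relation_def)
    show "refl_on V ?E"
      using subgroup.one_closed[OF SM] VF by (auto simp: refl_on_def coset_relation_def)
    show "sym ?E"
    proof (rule symI)
      fix p q assume pq: "(p, q) \<in> ?E"
      then have "free_inv (free_inv p \<cdot> q) \<in> M" by (simp add: coset_relation_def M_inv)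
      then show "(q, p) \<in> ?E" using pq VF by (simp add: coset_relation_def inv_mult_group)
    qed
    show "trans ?E"
    proof (rule transI)
      fix p q r assume pqr: "(p, q) \<in> ?E" "(q, r) \<in> ?E"
      then have "free_inv p \<cdot> q \<cdot> (free_inv q \<cdot> r) \<in> M" by (simp add: coset_relation_def M_mult)
      then show "(p, r) \<in> ?E" using pqr VF by (simp add: coset_relation_def m_assoc inv_cancel)
    qed
  qed
  show "(cancel_Cons a p, cancel_Cons a q) \<in> ?E"
    if "a \<in> X \<times> UNIV" "(p, q) \<in> ?E" "cancel_Cons a p \<in> V" "cancel_Cons a q \<in> V" for a p q
  proof -
    have "p \<in> F" "q \<in> F" "[a] \<in> F" using that VF singleton_F by (auto simp: coset_relation_def)
    then have "free_inv (cancel_Cons a p) \<cdot> cancel_Cons a q = free_inv p \<cdot> q"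
      by (simp add: singleton_mult[symmetric] inv_mult_group m_assoc inv_cancel)
    then show ?thesis using that by (simp add: coset_relation_def)
  qed
  show "T = {}" if T: "self_continuing V ?E T" for T
  proof (rule ccontr)
    assume "T \<noteq> {}"
    then obtain t where "t \<in> T" by blast
    define edge where "edge = (\<lambda>(a, p, q). a \<in> X \<times> UNIV \<and> p \<in> V \<and> q \<in> V \<and> cancel_Cons a p \<in> V \<and>
      cancel_Cons a q \<in> V \<and> (p, q) \<notin> ?E)"
    define cont where "cont = (\<lambda>(a, p, q) (b, p', q'). b \<noteq> inv_letter a \<and> (cancel_Cons a p, p') \<in> ?E \<and>
      (cancel_Cons a q, q') \<in> ?E)"
    have "\<forall>s\<in>T. edge s \<and> (\<exists>s'\<in>T. cont s s')"
      using T unfolding self_continuing_def edge_def cont_def by fastforce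
    then obtain f where f: "\<And>s. s \<in> T \<Longrightarrow> edge s \<and> f s \<in> T \<and> cont s (f s)"
      by metis
    define S where "S n = (f ^^ n) t" for n
    define A where "A n = fst (S n)" for n
    define P where "P n = fst (snd (S n))" for n
    define Q where "Q n = snd (snd (S n))" for n
    have S_T: "S n \<in> T" for n
      by (induction n) (use \<open>t \<in> T\<close> f in \<open>auto simp: S_def\<close>)
    have S_eq: "S n = (A n, P n, Q n)" for n by (simp add: A_def P_def Q_def)
    have A: "A n \<in> X \<times> UNIV" and PQ: "P n \<in> V" "Q n \<in> V" "(P n, Q n) \<notin> ?E" for n
      using f[OF S_T[of n]] unfolding S_eq edge_def by simp_all
    have "cont (S n) (S (Suc n))" for n
      using f[OF S_T[of n]] by (simp add: S_def)
    then have A_Suc: "A (Suc n) \<noteq> inv_letter (A n)"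
      and P_Suc: "(cancel_Cons (A n) (P n), P (Suc n)) \<in> ?E"
      and Q_Suc: "(cancel_Cons (A n) (Q n), Q (Suc n)) \<in> ?E" for n
      unfolding S_eq cont_def by simp_all
    \<comment> \<open>New letters are put in front, so the induction remembers the first letter of
      \<open>w\<close>; this shows that the next one does not cancel.\<close>
    have path: "\<exists>w. w \<in> F \<and> length w = m \<and> (w \<noteq> [] \<longrightarrow> hd w = A (n + m - 1)) \<and>
        free_inv (P (n + m)) \<cdot> w \<cdot> P n \<in> M \<and> free_inv (Q (n + m)) \<cdot> w \<cdot> Q n \<in> M" for n m
    proof (induction m)
      case 0
      then show ?case
        using PQ[of n] VF subgroup.one_closed[OF SM] by auto
    next
      case (Suc m)
      then obtain w where w: "w \<in> F" "length w = m" "w \<noteq> [] \<longrightarrow> hd w = A (n + m - 1)"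
        "free_inv (P (n + m)) \<cdot> w \<cdot> P n \<in> M" "free_inv (Q (n + m)) \<cdot> w \<cdot> Q n \<in> M"
        by blast
      let ?a = "A (n + m)"
      have "hd w \<noteq> inv_letter ?a" if "w \<noteq> []"
      proof -
        have "m \<noteq> 0" using that w(2) by auto
        then have "?a \<noteq> inv_letter (A (n + m - 1))" using A_Suc[of "n + m - 1"] by simp
        then show ?thesis using w(3) that by auto
      qed
      then have aw: "?a # w \<in> F" using w(1) A[of "n + m"] by (auto simp: F_iff reduced_Cons)
      note aw' = Cons_mult[OF aw]
      have step: "free_inv r' \<cdot> (?a # w) \<cdot> s \<in> M"
        if "(cancel_Cons ?a r, r') \<in> ?E" "free_inv r \<cdot> w \<cdot> s \<in> M" "r \<in> V" "s \<in> V" for r r' s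
      proof -
        have F: "r \<in> F" "s \<in> F" "r' \<in> F" using that VF by (auto simp: coset_relation_def)
        have "free_inv (free_inv (cancel_Cons ?a r) \<cdot> r') \<cdot> (free_inv r \<cdot> w \<cdot> s) \<in> M"
          using that by (simp only: coset_relation_def mem_Collect_eq prod.case M_mult M_inv)
        then show ?thesis
          using F aw' by (simp add: singleton_mult[symmetric] inv_mult_group m_assoc inv_cancel)
      qed
      have "free_inv (P (n + Suc m)) \<cdot> (?a # w) \<cdot> P n \<in> M"
        "free_inv (Q (n + Suc m)) \<cdot> (?a # w) \<cdot> Q n \<in> M"
        using step[OF P_Suc w(4)] step[OF Q_Suc w(5)] PQ(1,2) by simp_all
      then show ?case using aw w(2) by (intro exI[of _ "?a # w"]) auto
    qed
    have "finite T"
    proof (rule finite_subset)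
      show "T \<subseteq> (X \<times> UNIV) \<times> V \<times> V" using f unfolding edge_def by fastforce
    qed (use \<open>finite X\<close> V(1) in simp)
    then have "finite (range S)" using S_T by (meson finite_subset image_subsetI)
    then have "\<not> inj S" using finite_imageD by blast
    \<comment> \<open>The repetition yields a nonempty reduced word \<open>w\<close>. It need not be
      cyclically reduced, since only its nontriviality is used.\<close>
    then obtain i j where "S i = S j" "i < j" by (metis injI linorder_neqE_nat)
    then obtain n m where nm: "S n = S (n + m)" "m \<noteq> 0"
      using that[of i "j - i"] by simp
    obtain w where w: "w \<in> F" "length w = m" "free_inv (P n) \<cdot> w \<cdot> P n \<in> M"
      "free_inv (Q n) \<cdot> w \<cdot> Q n \<in> M"
      using path[where n = n and m = m] nm(1) by (auto simp: P_def Q_def)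
    have F: "P n \<in> F" "Q n \<in> F" using PQ VF by blast+
    \<comment> \<open>Conjugation by \<open>?g\<close> carries the element of \<open>M\<close>
      looping at \<open>P n\<close> to the one looping at \<open>Q n\<close>.\<close>
    let ?g = "free_inv (Q n) \<cdot> P n"
    have "?g \<cdot> (free_inv (P n) \<cdot> w \<cdot> P n) \<cdot> free_inv ?g \<in> M"
      using w F by (simp add: inv_mult_group m_assoc inv_cancel)
    moreover have "free_inv (P n) \<cdot> w \<cdot> P n \<noteq> \<one>\<^bsub>free_group X\<^esub>"
      using conj_eq_one_iff[of "free_inv (P n)" w] w F nm(2) by auto
    ultimately have "?g \<in> M"
      using malnormalD[OF M _ w(3)] F by simp
    then have "free_inv ?g \<in> M" by (rule M_inv)
    then have "(P n, Q n) \<in> ?E" using F PQ by (simp add: inv_mult_group coset_relation_def)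
    then show False using PQ(3) by blast
  qed
qed

end

context free_group_on
begin

text \<open>The loop group of every good relation takes part in the intersection defining
  \<open>M\<close>, hence contains \<open>M\<close>. For the coset relation of \<open>M\<close> the
  generators lie in \<open>M\<close>, so equality holds there. Comparing loop groups on
  \<open>V\<close> shows that this relation is the least good one.\<close>

lemma mal_tree:
  assumes "finite X" and V: "finite V" "V \<subseteq> F" "[] \<in> V" "\<forall>a p. a # p \<in> V \<longrightarrow> p \<in> V"
    and U: "U \<subseteq> V"
  defines "M \<equiv> mal (free_group X) (generate (free_group X) U)"
  shows "generate (free_group X) {free_inv p \<cdot> q | p q. (p, q) \<in> coset_relation V M} = M"
    and "(p, q) \<in> coset_relation V M \<longleftrightarrow>
      (\<forall>E. malnormal_tree X V E \<longrightarrow> (\<forall>u\<in>U. (u, []) \<in> E) \<longrightarrow> (p, q) \<in> E)"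
proof -
  let ?K = "generate (free_group X) U" and ?E = "coset_relation V M"
  have UF: "U \<subseteq> F" using U V(2) by blast
  have K: "?K \<subseteq> F" using generate_incl[OF UF] .
  have M: "malnormal (free_group X) M" unfolding M_def by (rule malnormal_mal[OF K])
  have KM: "?K \<subseteq> M" unfolding M_def by (rule subset_mal)
  note SM = malnormal_subgroup[OF M]
  have M_sub: "M \<subseteq> folded_tree.loop_group X E"
    if E: "malnormal_tree X V E" "\<forall>u\<in>U. (u, []) \<in> E" for E
  proof -
    interpret T: malnormal_tree X V E by (rule E(1))
    have "U \<subseteq> T.loop_group"
    proof
      fix u assume "u \<in> U"
      then have "free_inv [] \<cdot> u \<in> T.loop_group" "u \<in> F"
        using E(2) UF T.loop_group_gen T.E_sym by blast+
      then show "u \<in> T.loop_group" by simp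
    qed
    then have "?K \<subseteq> T.loop_group"
      by (rule generate_subgroup_incl[OF _ T.subgroup_loop_group])
    then show ?thesis
      unfolding M_def by (rule mal_subset[OF T.malnormal_loop_group])
  qed
  have tree: "malnormal_tree X V ?E"
    using malnormal_tree_coset_relation[OF assms(1) V(1-3) _ M] V(4) by blast
  have base: "(u, []) \<in> ?E" if "u \<in> U" for u
  proof -
    have "u \<in> M" by (rule subsetD[OF KM generate.incl[OF that]])
    then have "free_inv u \<in> M" "u \<in> F"
      using subgroup.m_inv_closed[OF SM] subgroup.mem_carrier[OF SM] by auto
    then show ?thesis using that U V(3) by (auto simp: coset_relation_def)
  qed
  interpret T: malnormal_tree X V ?E by (rule tree)
  have "T.loop_group \<subseteq> M"
    unfolding T.loop_group_def
    by (rule generate_subgroup_incl[OF _ SM]) (auto simp: coset_relation_def)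
  then show "generate (free_group X) {free_inv p \<cdot> q | p q. (p, q) \<in> ?E} = M"
    using M_sub[OF tree] base unfolding T.loop_group_def by blast
  show "(p, q) \<in> ?E \<longleftrightarrow> (\<forall>E. malnormal_tree X V E \<longrightarrow> (\<forall>u\<in>U. (u, []) \<in> E) \<longrightarrow> (p, q) \<in> E)"
  proof (intro iffI allI impI)
    fix E assume pq: "(p, q) \<in> ?E" and E: "malnormal_tree X V E" "\<forall>u\<in>U. (u, []) \<in> E"
    interpret T': malnormal_tree X V E by (rule E(1))
    have "p \<in> V" "q \<in> V" "free_inv p \<cdot> q \<in> T'.loop_group"
      using pq M_sub[OF E] by (auto simp: coset_relation_def)
    then show "(p, q) \<in> E" using T'.E_iff_loop_group by blast
  qed (use tree base in blast)
qed

lemma finite_words_bounded: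
  assumes "finite X" shows "finite {w \<in> F. length w \<le> n}"
proof (rule finite_subset)
  show "{w \<in> F. length w \<le> n} \<subseteq> {w. set w \<subseteq> X \<times> UNIV \<and> length w \<le> n}"
    by (auto simp: F_iff)
qed (use assms in \<open>simp add: finite_lists_length_le\<close>)

lemma finitely_generated_mal:
  assumes "finite X" "finitely_generated (free_group X) K"
  shows "finitely_generated (free_group X) (mal (free_group X) K)"
proof -
  obtain U where U: "finite U" "U \<subseteq> F" "K = generate (free_group X) U"
    using assms(2) unfolding finitely_generated_def by blast
  \<comment> \<open>A ball of the Cayley tree is suffix-closed; \<open>insert 0\<close> covers an
    empty generating set.\<close>
  define V where "V = {w \<in> F. length w \<le> Max (insert 0 (length ` U))}"
  have V: "finite V" "V \<subseteq> F" "[] \<in> V"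
    unfolding V_def using finite_words_bounded[OF assms(1)] by auto
  have suffix: "\<forall>a p. a # p \<in> V \<longrightarrow> p \<in> V"
    using Cons_mult(2) by (auto simp: V_def)
  have UV: "U \<subseteq> V" using U(1,2) by (auto simp: V_def)
  let ?M = "mal (free_group X) K"
  let ?S = "{free_inv p \<cdot> q | p q. (p, q) \<in> coset_relation V ?M}"
  have "?S \<subseteq> (\<lambda>(p, q). free_inv p \<cdot> q) ` (V \<times> V)" by (auto simp: coset_relation_def)
  then have "finite ?S" using V(1) by (meson finite_SigmaI finite_imageI finite_subset)
  moreover have "?S \<subseteq> F" using V(2) by (auto simp: coset_relation_def)
  moreover have "?M = generate (free_group X) ?S"
    using mal_tree(1)[OF assms(1) V suffix UV] unfolding U(3) by simp
  ultimately show ?thesis unfolding finitely_generated_def by blast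
qed

end

section \<open>Recursive functions\<close>

text \<open>The argument list is an environment in which a bound variable is pushed in front, so that
  the rules below unify with goals whose variables have the form \<open>hd (tl \<dots> (tl xs))\<close>.\<close>

definition computable_on :: "nat \<Rightarrow> (nat list \<Rightarrow> nat) \<Rightarrow> bool" where
  "computable_on k f \<longleftrightarrow> (\<exists>r. recursive k r \<and> (\<forall>xs. length xs = k \<longrightarrow> f xs = r xs))"

lemma computable_on_cong:
  "computable_on k f \<Longrightarrow> (\<And>xs. length xs = k \<Longrightarrow> g xs = f xs) \<Longrightarrow> computable_on k g"
  unfolding computable_on_def by fastforce

lemma computable_on_comp:
  assumes "computable_on (length gs) f" "\<forall>g\<in>set gs. computable_on k g"
  shows "computable_on k (\<lambda>xs. f (map (\<lambda>g. g xs) gs))"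
proof -
  obtain r where r: "recursive (length gs) r" "\<And>xs. length xs = length gs \<Longrightarrow> f xs = r xs"
    using assms(1) unfolding computable_on_def by blast
  obtain c where c: "\<And>g. g \<in> set gs \<Longrightarrow> recursive k (c g)"
    "\<And>g xs. g \<in> set gs \<Longrightarrow> length xs = k \<Longrightarrow> g xs = c g xs"
    using assms(2) unfolding computable_on_def by metis
  have "recursive k (\<lambda>xs. r (map (\<lambda>g. g xs) (map c gs)))"
    by (rule recursive.comp) (use r(1) c(1) in auto)
  moreover have "f (map (\<lambda>g. g xs) gs) = r (map (\<lambda>g. g xs) (map c gs))" if "length xs = k" for xs
  proof -
    have "map (\<lambda>g. g xs) gs = map (\<lambda>g. g xs) (map c gs)"
      using c(2) that by simp
    then show ?thesis using r(2)[of "map (\<lambda>g. g xs) gs"] by (metis length_map)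
  qed
  ultimately show ?thesis unfolding computable_on_def by blast
qed

lemma computable_on_nth: "i < k \<Longrightarrow> computable_on k (\<lambda>xs. xs ! i)"
  unfolding computable_on_def using recursive.proj by blast

text \<open>Weakening by a variable in front: composition with the shifted projections.\<close>

lemma computable_on_tl:
  assumes "computable_on k f"
  shows "computable_on (Suc k) (\<lambda>ys. f (tl ys))"
proof -
  let ?gs = "map (\<lambda>i xs. xs ! Suc i) [0..<k] :: (nat list \<Rightarrow> nat) list"
  have "computable_on (Suc k) (\<lambda>xs. f (map (\<lambda>g. g xs) ?gs))"
    by (rule computable_on_comp) (use assms in \<open>auto intro: computable_on_nth\<close>)
  then show ?thesis
    by (rule computable_on_cong) (auto intro!: arg_cong[where f = f] nth_equalityI simp: nth_tl)
qed

lemma computable_on_hd: "computable_on (Suc k) hd"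
  by (rule computable_on_cong[OF computable_on_nth[of 0]]) (auto simp: length_Suc_conv)

lemmas computable_on_var0 = computable_on_hd
lemmas computable_on_var1 = computable_on_var0[THEN computable_on_tl]
lemmas computable_on_var2 = computable_on_var1[THEN computable_on_tl]
lemmas computable_on_var3 = computable_on_var2[THEN computable_on_tl]
lemmas computable_on_var4 = computable_on_var3[THEN computable_on_tl]
lemmas computable_on_var5 = computable_on_var4[THEN computable_on_tl]
lemmas computable_on_var6 = computable_on_var5[THEN computable_on_tl]
lemmas computable_on_var7 = computable_on_var6[THEN computable_on_tl]
lemmas computable_on_var8 = computable_on_var7[THEN computable_on_tl]
lemmas computable_on_var9 = computable_on_var8[THEN computable_on_tl]

lemmas computable_on_vars = computable_on_var0 computable_on_var1 computable_on_var2
  computable_on_var3 computable_on_var4 computable_on_var5 computable_on_var6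
  computable_on_var7 computable_on_var8 computable_on_var9

lemma computable_on_Suc:
  assumes "computable_on k f" shows "computable_on k (\<lambda>xs. Suc (f xs))"
proof -
  have "computable_on (length [f]) (\<lambda>xs. Suc (xs ! 0))"
    unfolding computable_on_def using recursive.suc by auto
  from computable_on_comp[OF this, of k] assms show ?thesis by simp
qed

lemma computable_on_const: "computable_on k (\<lambda>_. c)"
proof (induction c)
  case 0
  then show ?case unfolding computable_on_def using recursive.zero by blast
qed (rule computable_on_Suc)

text \<open>The primitive recursion scheme takes its bound from the head of the argument list.
  Composing it with \<open>b\<close> and all projections allows the bound to be any computable
  function of the environment.\<close>

lemma computable_on_rec_nat:
  assumes f: "computable_on k f" and b: "computable_on k b"
    and h: "computable_on (Suc (Suc k)) (\<lambda>ys. h (hd ys) (hd (tl ys)) (tl (tl ys)))"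
  shows "computable_on k (\<lambda>xs. rec_nat (f xs) (\<lambda>n r. h n r xs) (b xs))"
proof -
  obtain f' h' where f': "recursive k f'" "\<And>xs. length xs = k \<Longrightarrow> f xs = f' xs"
    and h': "recursive (Suc (Suc k)) h'"
      "\<And>n r xs. length xs = k \<Longrightarrow> h n r xs = h' (n # r # xs)"
  proof -
    obtain f' where "recursive k f'" "\<And>xs. length xs = k \<Longrightarrow> f xs = f' xs"
      using f unfolding computable_on_def by blast
    moreover obtain h' where h': "recursive (Suc (Suc k)) h'"
      "\<And>ys. length ys = Suc (Suc k) \<Longrightarrow> h (hd ys) (hd (tl ys)) (tl (tl ys)) = h' ys"
      using h unfolding computable_on_def by blast
    moreover have "h n r xs = h' (n # r # xs)" if "length xs = k" for n r xs
      using h'(2)[of "n # r # xs"] that by simp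
    ultimately show ?thesis using that by blast
  qed
  let ?p = "\<lambda>xs. rec_nat (f' (tl xs)) (\<lambda>n r. h' (n # r # tl xs)) (hd xs)"
  let ?gs = "b # map (\<lambda>i xs. xs ! i) [0..<k]"
  have p: "computable_on (length ?gs) ?p"
    unfolding computable_on_def using recursive.prim_rec[OF f'(1) h'(1)] by auto
  have "computable_on k (\<lambda>xs. ?p (map (\<lambda>g. g xs) ?gs))"
    by (rule computable_on_comp[OF p]) (use b in \<open>auto intro: computable_on_nth\<close>)
  then show ?thesis
  proof (rule computable_on_cong)
    fix xs :: "nat list" assume k: "length xs = k"
    then have "map (\<lambda>g. g xs) (map (\<lambda>i xs. xs ! i) [0..<k]) = xs"
      by (auto intro: nth_equalityI)
    then show "rec_nat (f xs) (\<lambda>n r. h n r xs) (b xs) = ?p (map (\<lambda>g. g xs) ?gs)"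
      using f'(2) h'(2) k by simp
  qed
qed

lemma computable_on_tl2:
  "computable_on k f \<Longrightarrow> computable_on (Suc (Suc k)) (\<lambda>ys. f (tl (tl ys)))"
  by (intro computable_on_tl[where f = "\<lambda>ys. f (tl ys)"] computable_on_tl)

lemma computable_on_add:
  assumes "computable_on k f" "computable_on k g"
  shows "computable_on k (\<lambda>xs. f xs + g xs)"
proof -
  have "computable_on k (\<lambda>xs. rec_nat (f xs) (\<lambda>n r. Suc r) (g xs))"
    by (intro computable_on_rec_nat assms computable_on_Suc computable_on_vars)
  moreover have "rec_nat a (\<lambda>n r. Suc r) b = a + b" for a b :: nat by (induction b) auto
  ultimately show ?thesis by simp
qed

lemma computable_on_mult:
  assumes "computable_on k f" "computable_on k g"
  shows "computable_on k (\<lambda>xs. f xs * g xs)"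
proof -
  have "computable_on k (\<lambda>xs. rec_nat 0 (\<lambda>n r. r + f xs) (g xs))"
    by (intro computable_on_rec_nat assms computable_on_const computable_on_add computable_on_vars
        computable_on_tl2)
  moreover have "rec_nat 0 (\<lambda>n r. r + a) b = a * b" for a b :: nat by (induction b) auto
  ultimately show ?thesis by simp
qed

lemma computable_on_power:
  assumes "computable_on k f" "computable_on k g"
  shows "computable_on k (\<lambda>xs. f xs ^ g xs)"
proof -
  have "computable_on k (\<lambda>xs. rec_nat 1 (\<lambda>n r. r * f xs) (g xs))"
    by (intro computable_on_rec_nat assms computable_on_const computable_on_mult computable_on_vars
        computable_on_tl2)
  moreover have "rec_nat 1 (\<lambda>n r. r * a) b = a ^ b" for a b :: nat by (induction b) auto
  ultimately show ?thesis by simp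
qed

lemma computable_on_diff:
  assumes "computable_on k f" "computable_on k g"
  shows "computable_on k (\<lambda>xs. f xs - g xs)"
proof -
  have pred: "computable_on k' (\<lambda>xs. h xs - 1)" if "computable_on k' h" for k' h
  proof -
    have "computable_on k' (\<lambda>xs. rec_nat 0 (\<lambda>n r. n) (h xs))"
      by (intro computable_on_rec_nat that computable_on_const computable_on_vars)
    moreover have "rec_nat 0 (\<lambda>n r. n) a = a - 1" for a :: nat by (cases a) auto
    ultimately show ?thesis by simp
  qed
  have "computable_on k (\<lambda>xs. rec_nat (f xs) (\<lambda>n r. r - 1) (g xs))"
    by (intro computable_on_rec_nat assms pred computable_on_vars)
  moreover have "rec_nat a (\<lambda>n r. r - 1) b = a - b" for a b :: nat by (induction b) auto
  ultimately show ?thesis by simp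
qed

lemma computable_on_sum:
  assumes "computable_on k b" "computable_on (Suc k) (\<lambda>ys. f (hd ys) (tl ys))"
  shows "computable_on k (\<lambda>xs. \<Sum>i<b xs. f i xs)"
proof -
  \<comment> \<open>The recursion step sees the counter, the accumulator and the environment; this
    selection skips the accumulator, which the summand ignores.\<close>
  let ?gs = "(\<lambda>xs. xs ! 0) # map (\<lambda>i xs. xs ! Suc (Suc i)) [0..<k] :: (nat list \<Rightarrow> nat) list"
  have "computable_on (Suc (Suc k)) (\<lambda>xs. (\<lambda>ys. f (hd ys) (tl ys)) (map (\<lambda>g. g xs) ?gs))"
    by (rule computable_on_comp) (use assms in \<open>auto intro: computable_on_nth\<close>)
  then have f: "computable_on (Suc (Suc k)) (\<lambda>ys. f (hd ys) (tl (tl ys)))"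
    by (rule computable_on_cong)
      (auto intro!: arg_cong2[where f = f] nth_equalityI simp: nth_tl length_Suc_conv)
  have "computable_on k (\<lambda>xs. rec_nat 0 (\<lambda>n r. r + f n xs) (b xs))"
    by (intro computable_on_rec_nat assms computable_on_const computable_on_add f
        computable_on_vars)
  moreover have "rec_nat 0 (\<lambda>n r. r + h n) m = (\<Sum>i<m. h i)" for h :: "nat \<Rightarrow> nat" and m
    by (induction m) auto
  ultimately show ?thesis by simp
qed

section \<open>Decidable predicates and bounded quantifiers\<close>

definition decidable_on :: "nat \<Rightarrow> (nat list \<Rightarrow> bool) \<Rightarrow> bool" where
  "decidable_on k P \<longleftrightarrow> computable_on k (\<lambda>xs. of_bool (P xs))"

lemma decidable_on_not: "decidable_on k P \<Longrightarrow> decidable_on k (\<lambda>xs. \<not> P xs)"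
  unfolding decidable_on_def
  by (rule computable_on_cong[OF computable_on_diff[OF computable_on_const[of k 1]]]) auto

lemma decidable_on_conj:
  "decidable_on k P \<Longrightarrow> decidable_on k Q \<Longrightarrow> decidable_on k (\<lambda>xs. P xs \<and> Q xs)"
  unfolding decidable_on_def of_bool_conj by (rule computable_on_mult)

lemma decidable_on_disj:
  "decidable_on k P \<Longrightarrow> decidable_on k Q \<Longrightarrow> decidable_on k (\<lambda>xs. P xs \<or> Q xs)"
  using decidable_on_not[OF decidable_on_conj[OF decidable_on_not decidable_on_not]] by simp

lemma decidable_on_imp:
  "decidable_on k P \<Longrightarrow> decidable_on k Q \<Longrightarrow> decidable_on k (\<lambda>xs. P xs \<longrightarrow> Q xs)"
  unfolding imp_conv_disj by (intro decidable_on_disj decidable_on_not)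

lemma decidable_on_le:
  assumes "computable_on k f" "computable_on k g"
  shows "decidable_on k (\<lambda>xs. f xs \<le> g xs)"
  unfolding decidable_on_def
  by (rule computable_on_cong[OF computable_on_diff[OF computable_on_const[of k 1]
          computable_on_diff[OF assms]]]) auto

lemma decidable_on_less:
  "computable_on k f \<Longrightarrow> computable_on k g \<Longrightarrow> decidable_on k (\<lambda>xs. f xs < g xs)"
  unfolding Suc_le_eq[symmetric] by (intro decidable_on_le computable_on_Suc)

lemma decidable_on_eq:
  "computable_on k f \<Longrightarrow> computable_on k g \<Longrightarrow> decidable_on k (\<lambda>xs. f xs = g xs)"
  unfolding order_eq_iff by (intro decidable_on_conj decidable_on_le)

text \<open>A bounded universal statement holds iff the number of its counterexamples is zero, and
  that number is a bounded sum.\<close>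

lemma decidable_on_all:
  assumes "computable_on k b" "decidable_on (Suc k) (\<lambda>ys. P (hd ys) (tl ys))"
  shows "decidable_on k (\<lambda>xs. \<forall>i<b xs. P i xs)"
proof -
  have "decidable_on k (\<lambda>xs. (\<Sum>i<b xs. of_bool (\<not> P i xs)) = (0::nat))"
    by (intro decidable_on_eq computable_on_sum computable_on_const assms(1)
        decidable_on_not[OF assms(2), unfolded decidable_on_def])
  moreover have "(\<Sum>i<m. of_bool (\<not> Q i)) = (0::nat) \<longleftrightarrow> (\<forall>i<m. Q i)" for Q and m :: nat
    by (subst sum_eq_0_iff) auto
  ultimately show ?thesis by simp
qed

lemma decidable_on_ex:
  assumes "computable_on k b" "decidable_on (Suc k) (\<lambda>ys. P (hd ys) (tl ys))"
  shows "decidable_on k (\<lambda>xs. \<exists>i<b xs. P i xs)"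
  using decidable_on_not[OF decidable_on_all[OF assms(1) decidable_on_not[OF assms(2)]]] by simp

lemma decidable_on_finite:
  assumes "finite A" "computable_on k f"
  shows "decidable_on k (\<lambda>xs. f xs \<in> A)"
  using assms(1)
proof induction
  case empty
  then show ?case by (simp add: decidable_on_def computable_on_const)
next
  case (insert a A)
  then show ?case
    using decidable_on_disj[OF decidable_on_eq[OF assms(2) computable_on_const[of k a]]] by simp
qed

lemma computable_on_if:
  assumes "decidable_on k P" "computable_on k f" "computable_on k g"
  shows "computable_on k (\<lambda>xs. if P xs then f xs else g xs)"
proof -
  have "computable_on k (\<lambda>xs. of_bool (P xs) * f xs + (1 - of_bool (P xs)) * g xs)"
    using assms(1) unfolding decidable_on_def
    by (intro computable_on_add computable_on_mult computable_on_diff computable_on_const assms(2,3))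
  then show ?thesis by (rule computable_on_cong) auto
qed

section \<open>Arithmetic of pairs and of finite sets\<close>

lemma computable_on_prod_encode:
  assumes "computable_on k f" "computable_on k g"
  shows "computable_on k (\<lambda>xs. prod_encode (f xs, g xs))"
proof -
  have "computable_on k (\<lambda>xs. (\<Sum>i<Suc (f xs + g xs). i) + f xs)"
    by (intro computable_on_add computable_on_sum computable_on_Suc computable_on_vars assms)
  moreover have "(\<Sum>i<Suc m. i) = triangle m" for m
    by (induction m) auto
  ultimately show ?thesis by (simp add: prod_encode_def)
qed

text \<open>Unpairing as a bounded sum: both components are at most \<open>z\<close>, and
  injectivity of the pairing leaves a single nonzero summand to consider.\<close>

lemma prod_decode_sum:
  "(\<Sum>x<Suc z. \<Sum>y<Suc z. if prod_encode (x, y) = z then h x y else 0)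
     = (h (fst (prod_decode z)) (snd (prod_decode z)) :: nat)"
proof -
  obtain a b where z: "z = prod_encode (a, b)"
    by (metis prod_decode_inverse surj_pair)
  have "a < Suc z" "b < Suc z"
    using le_prod_encode_1[of a b] le_prod_encode_2[of b a] z by auto
  moreover have "(if prod_encode (x, y) = z then h x y else 0)
      = (if y = b then if x = a then h a b else 0 else 0)" for x y
    using z by (auto simp: prod_encode_eq)
  ultimately show ?thesis by (simp add: z sum.delta del: sum.lessThan_Suc)
qed

lemma computable_on_fst_prod_decode:
  assumes "computable_on k f"
  shows "computable_on k (\<lambda>xs. fst (prod_decode (f xs)))"
  unfolding prod_decode_sum[where h = "\<lambda>x y. x", symmetric]
  by (intro computable_on_sum computable_on_Suc assms computable_on_if decidable_on_eq
      computable_on_prod_encode computable_on_vars computable_on_const computable_on_tl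
      computable_on_tl2)

lemma computable_on_snd_prod_decode:
  assumes "computable_on k f"
  shows "computable_on k (\<lambda>xs. snd (prod_decode (f xs)))"
  unfolding prod_decode_sum[where h = "\<lambda>x y. y", symmetric]
  by (intro computable_on_sum computable_on_Suc assms computable_on_if decidable_on_eq
      computable_on_prod_encode computable_on_vars computable_on_const computable_on_tl
      computable_on_tl2)

text \<open>The binary digit at position \<open>z\<close> is isolated: \<open>q\<close> holds the
  higher digits and \<open>r\<close> the lower ones. Only bounded quantifiers, sums, products and
  powers occur, so division need not be treated.\<close>

lemma mem_set_decode_iff:
  "z \<in> set_decode s \<longleftrightarrow> (\<exists>q<Suc s. \<exists>r<2 ^ z. s = (2 * q + 1) * 2 ^ z + r)"
proof
  assume "z \<in> set_decode s"
  then have o: "odd (s div 2 ^ z)" by (simp add: set_decode_def)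
  then obtain q where q: "s div 2 ^ z = 2 * q + 1" by (auto elim: oddE)
  have "s = (s div 2 ^ z) * 2 ^ z + s mod 2 ^ z" by (rule div_mult_mod_eq[symmetric])
  then have "s = (2 * q + 1) * 2 ^ z + s mod 2 ^ z" by (simp only: q)
  moreover have "q < Suc s"
    using q div_le_dividend[of s "2 ^ z"] by linarith
  ultimately show "\<exists>q<Suc s. \<exists>r<2 ^ z. s = (2 * q + 1) * 2 ^ z + r"
    by (metis mod_less_divisor zero_less_numeral zero_less_power)
next
  assume "\<exists>q<Suc s. \<exists>r<2 ^ z. s = (2 * q + 1) * 2 ^ z + r"
  then obtain q r where "r < 2 ^ z" "s = (2 * q + 1) * 2 ^ z + r" by blast
  then have "s div 2 ^ z = 2 * q + 1"
    by (intro div_nat_eqI) (simp_all add: algebra_simps)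
  then show "z \<in> set_decode s" by (simp add: set_decode_def)
qed

lemma decidable_on_set_decode:
  assumes "computable_on k f" "computable_on k g"
  shows "decidable_on k (\<lambda>xs. f xs \<in> set_decode (g xs))"
  unfolding mem_set_decode_iff
  by (intro decidable_on_ex decidable_on_eq computable_on_Suc computable_on_add computable_on_mult
      computable_on_power computable_on_const assms computable_on_vars computable_on_tl
      computable_on_tl2)

lemmas computability_intros =
  computable_on_vars computable_on_const computable_on_Suc computable_on_add computable_on_mult
  computable_on_power computable_on_diff computable_on_if
  computable_on_prod_encode computable_on_fst_prod_decode computable_on_snd_prod_decode
  decidable_on_not decidable_on_conj decidable_on_disj decidable_on_imp decidable_on_eq
  decidable_on_le decidable_on_less decidable_on_all decidable_on_ex decidable_on_set_decode

text \<open>Substitution of arbitrary arguments. With it a definition is unfolded only once, with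
  plain variables as arguments.\<close>

lemma computable_on_comp1:
  assumes "computable_on 1 (\<lambda>xs. h (hd xs))" "computable_on k f"
  shows "computable_on k (\<lambda>xs. h (f xs))"
  using computable_on_comp[of "[f]" "\<lambda>xs. h (hd xs)" k] assms by simp

lemma computable_on_comp2:
  assumes "computable_on 2 (\<lambda>xs. h (hd xs) (hd (tl xs)))" "computable_on k f" "computable_on k g"
  shows "computable_on k (\<lambda>xs. h (f xs) (g xs))"
  using computable_on_comp[of "[f, g]" "\<lambda>xs. h (hd xs) (hd (tl xs))" k] assms
  by (simp add: numeral_2_eq_2)

lemma computable_on_comp3:
  assumes "computable_on 3 (\<lambda>xs. h (hd xs) (hd (tl xs)) (hd (tl (tl xs))))"
    "computable_on k f" "computable_on k g" "computable_on k g'"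
  shows "computable_on k (\<lambda>xs. h (f xs) (g xs) (g' xs))"
  using computable_on_comp[of "[f, g, g']" "\<lambda>xs. h (hd xs) (hd (tl xs)) (hd (tl (tl xs)))" k] assms
  by (simp add: numeral_3_eq_3)

lemmas decidable_on_comp1 = computable_on_comp1[where h = "\<lambda>x. of_bool (P x)" for P,
    folded decidable_on_def]
lemmas decidable_on_comp2 = computable_on_comp2[where h = "\<lambda>x y. of_bool (P x y)" for P,
    folded decidable_on_def]
lemmas decidable_on_comp3 = computable_on_comp3[where h = "\<lambda>x y z. of_bool (P x y z)" for P,
    folded decidable_on_def]

lemma computable_on_funpow:
  assumes "computable_on 1 (\<lambda>xs. h (hd xs))" "computable_on k n" "computable_on k f"
  shows "computable_on k (\<lambda>xs. (h ^^ n xs) (f xs))"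
proof -
  have "computable_on k (\<lambda>xs. rec_nat (f xs) (\<lambda>_ r. h r) (n xs))"
    by (intro computable_on_rec_nat computable_on_comp1[OF assms(1)] assms(2,3) computable_on_vars)
  moreover have "rec_nat x (\<lambda>_ r. h r) m = (h ^^ m) x" for m x by (induction m) auto
  ultimately show ?thesis by simp
qed

section \<open>Arithmetic on codes of words\<close>

definition hd_code :: "nat \<Rightarrow> nat" where
  "hd_code z = fst (prod_decode (z - 1))"

text \<open>Subtracting 1 undoes the \<open>Suc\<close> in the code of a nonempty list, here and in
  \<open>hd_code\<close>. Truncated subtraction makes 0, the code of the empty list, its own
  tail.\<close>

definition tl_code :: "nat \<Rightarrow> nat" where
  "tl_code z = snd (prod_decode (z - 1))"

definition cons_code :: "nat \<Rightarrow> nat \<Rightarrow> nat" where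
  "cons_code a z = Suc (prod_encode (a, z))"

definition inv_code :: "nat \<Rightarrow> nat" where
  "inv_code a = prod_encode (fst (prod_decode a), 1 - snd (prod_decode a))"

definition cancel_code :: "nat \<Rightarrow> nat \<Rightarrow> nat" where
  "cancel_code a z = (if z \<noteq> 0 \<and> hd_code z = inv_code a then tl_code z else cons_code a z)"

text \<open>The state pairs the unread part of \<open>p\<close> with the current value, onto which
  the inverse of each letter read is multiplied from the left. A state with nothing left to read is
  fixed.\<close>

definition div_step :: "nat \<Rightarrow> nat" where
  "div_step z = (let p = fst (prod_decode z); q = snd (prod_decode z) in
     if p = 0 then z else prod_encode (tl_code p, cancel_code (inv_code (hd_code p)) q))"

text \<open>A word is no longer than its code, so \<open>p\<close> steps suffice, and surplus steps
  change nothing.\<close>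

definition div_code :: "nat \<Rightarrow> nat \<Rightarrow> nat" where
  "div_code p q = snd (prod_decode ((div_step ^^ p) (prod_encode (p, q))))"

definition entry_code :: "nat \<Rightarrow> nat \<Rightarrow> bool" where
  "entry_code n u \<longleftrightarrow> (\<exists>i<n. (tl_code ^^ i) n \<noteq> 0 \<and> hd_code ((tl_code ^^ i) n) = u)"

definition valid_code :: "nat set \<Rightarrow> nat \<Rightarrow> bool" where
  "valid_code L z \<longleftrightarrow> (\<forall>i<z. let v = (tl_code ^^ i) z in v \<noteq> 0 \<longrightarrow>
     hd_code v \<in> L \<and> (tl_code v \<noteq> 0 \<longrightarrow> hd_code (tl_code v) \<noteq> inv_code (hd_code v)))"

lemma computable_on_hd_code: "computable_on k f \<Longrightarrow> computable_on k (\<lambda>xs. hd_code (f xs))"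
  unfolding hd_code_def by (intro computability_intros)

lemma computable_on_tl_code: "computable_on k f \<Longrightarrow> computable_on k (\<lambda>xs. tl_code (f xs))"
  unfolding tl_code_def by (intro computability_intros)

lemma computable_on_cons_code:
  "computable_on k f \<Longrightarrow> computable_on k g \<Longrightarrow> computable_on k (\<lambda>xs. cons_code (f xs) (g xs))"
  unfolding cons_code_def by (intro computability_intros)

lemma computable_on_inv_code: "computable_on k f \<Longrightarrow> computable_on k (\<lambda>xs. inv_code (f xs))"
  unfolding inv_code_def by (intro computability_intros)

lemma computable_on_cancel_code:
  "computable_on k f \<Longrightarrow> computable_on k g \<Longrightarrow> computable_on k (\<lambda>xs. cancel_code (f xs) (g xs))"
  unfolding cancel_code_def
  by (intro computability_intros computable_on_hd_code computable_on_inv_code computable_on_tl_code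
      computable_on_cons_code)

lemmas code_intros = computability_intros computable_on_hd_code computable_on_tl_code
  computable_on_cons_code computable_on_inv_code computable_on_cancel_code

lemma computable_on_div_code:
  assumes "computable_on k f" "computable_on k g"
  shows "computable_on k (\<lambda>xs. div_code (f xs) (g xs))"
proof -
  have "computable_on 1 (\<lambda>xs. div_step (hd xs))"
    unfolding div_step_def Let_def One_nat_def by (intro code_intros)
  then show ?thesis
    unfolding div_code_def by (intro code_intros computable_on_funpow[of div_step] assms)
qed

lemma computable_on_tl_code_funpow:
  "computable_on k n \<Longrightarrow> computable_on k f \<Longrightarrow> computable_on k (\<lambda>xs. (tl_code ^^ n xs) (f xs))"
  unfolding One_nat_def by (rule computable_on_funpow) (simp_all add: code_intros)

lemma decidable_on_entry_code:
  "computable_on k f \<Longrightarrow> computable_on k g \<Longrightarrow> decidable_on k (\<lambda>xs. entry_code (f xs) (g xs))"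
  by (rule decidable_on_comp2[of entry_code], unfold entry_code_def numeral_2_eq_2)
    (intro code_intros computable_on_tl_code_funpow)

lemma decidable_on_valid_code:
  "finite L \<Longrightarrow> computable_on k f \<Longrightarrow> decidable_on k (\<lambda>xs. valid_code L (f xs))"
  by (rule decidable_on_comp1[of "valid_code L"], unfold valid_code_def Let_def One_nat_def)
    (intro code_intros computable_on_tl_code_funpow decidable_on_finite)

text \<open>\<open>L\<close> is the set of codes of letters, \<open>m\<close> a bound for it, and \<open>n\<close> the code of a list of words.
  The vertices are the codes up to \<open>n\<close> of reduced words; relations on them and sets of triples are
  given by the binary expansions of \<open>s\<close> and \<open>T\<close>.\<close>

definition vertex_code :: "nat set \<Rightarrow> nat \<Rightarrow> nat \<Rightarrow> bool" where
  "vertex_code L n p \<longleftrightarrow> p \<le> n \<and> valid_code L p"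

definition rel_code :: "nat \<Rightarrow> nat \<Rightarrow> nat \<Rightarrow> bool" where
  "rel_code s p q \<longleftrightarrow> prod_encode (p, q) \<in> set_decode s"

definition triple_code :: "nat \<Rightarrow> nat \<Rightarrow> nat \<Rightarrow> nat" where
  "triple_code a p q = prod_encode (a, prod_encode (p, q))"

definition continuable_code :: "nat set \<Rightarrow> nat \<Rightarrow> nat \<Rightarrow> nat \<Rightarrow> nat \<Rightarrow> nat \<Rightarrow> nat \<Rightarrow> nat \<Rightarrow> bool" where
  "continuable_code L m n s T a p q \<longleftrightarrow>
     (\<exists>b<Suc m. b \<in> L \<and> (\<exists>p'<Suc n. vertex_code L n p' \<and> (\<exists>q'<Suc n. vertex_code L n q' \<and>
        triple_code b p' q' \<in> set_decode T \<and> b \<noteq> inv_code a \<and>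
        rel_code s (cancel_code a p) p' \<and> rel_code s (cancel_code a q) q')))"

text \<open>Every element of \<open>T\<close> up to the bound must decode to an admissible triple.
  The bound covers all triples of letters and vertices because the pairing is monotone.\<close>

definition self_continuing_code :: "nat set \<Rightarrow> nat \<Rightarrow> nat \<Rightarrow> nat \<Rightarrow> nat \<Rightarrow> bool" where
  "self_continuing_code L m n s T \<longleftrightarrow> (\<forall>z<Suc (triple_code m n n). z \<in> set_decode T \<longrightarrow>
     (\<exists>a<Suc m. a \<in> L \<and> (\<exists>p<Suc n. vertex_code L n p \<and> (\<exists>q<Suc n. vertex_code L n q \<and>
        z = triple_code a p q \<and>
        vertex_code L n (cancel_code a p) \<and> vertex_code L n (cancel_code a q) \<and>
        \<not> rel_code s p q \<and> continuable_code L m n s T a p q))))"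

definition fold_code :: "nat set \<Rightarrow> nat \<Rightarrow> nat \<Rightarrow> nat \<Rightarrow> bool" where
  "fold_code L m n s \<longleftrightarrow> (\<forall>a<Suc m. a \<in> L \<longrightarrow> (\<forall>p<Suc n. vertex_code L n p \<longrightarrow>
     (\<forall>q<Suc n. vertex_code L n q \<longrightarrow> rel_code s p q \<longrightarrow> vertex_code L n (cancel_code a p) \<longrightarrow>
        vertex_code L n (cancel_code a q) \<longrightarrow> rel_code s (cancel_code a p) (cancel_code a q))))"

definition equiv_code :: "nat set \<Rightarrow> nat \<Rightarrow> nat \<Rightarrow> bool" where
  "equiv_code L n s \<longleftrightarrow> (\<forall>p<Suc n. vertex_code L n p \<longrightarrow> rel_code s p p \<and>
     (\<forall>q<Suc n. vertex_code L n q \<longrightarrow> rel_code s p q \<longrightarrow> rel_code s q p \<and>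
       (\<forall>r<Suc n. vertex_code L n r \<longrightarrow> rel_code s q r \<longrightarrow> rel_code s p r)))"

text \<open>In the third condition 0 is the code of the empty word. In the last, \<open>T\<close>
  runs through the binary codes of all sets of numbers up to \<open>triple_code m n n\<close>, and 0
  codes the empty set.\<close>

definition good_code :: "nat set \<Rightarrow> nat \<Rightarrow> nat \<Rightarrow> nat \<Rightarrow> bool" where
  "good_code L m n s \<longleftrightarrow> equiv_code L n s \<and> fold_code L m n s \<and>
     (\<forall>u<Suc n. vertex_code L n u \<longrightarrow> entry_code n u \<longrightarrow> rel_code s u 0) \<and>
     (\<forall>T<2 ^ Suc (triple_code m n n). self_continuing_code L m n s T \<longrightarrow> T = 0)"

text \<open>The least good relation as the intersection of all good ones. Digits of \<open>s\<close>
  outside the pairs of vertices are never inspected, so several \<open>s\<close> may code one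
  relation.\<close>

definition mal_eq_code :: "nat set \<Rightarrow> nat \<Rightarrow> nat \<Rightarrow> nat \<Rightarrow> nat \<Rightarrow> bool" where
  "mal_eq_code L m n p q \<longleftrightarrow>
     (\<forall>s<2 ^ Suc (prod_encode (n, n)). good_code L m n s \<longrightarrow> rel_code s p q)"

definition gens_step :: "nat set \<Rightarrow> nat \<Rightarrow> nat \<Rightarrow> nat \<Rightarrow> nat \<Rightarrow> nat" where
  "gens_step L m n z r = (let p = fst (prod_decode z); q = snd (prod_decode z) in
     if vertex_code L n p \<and> vertex_code L n q \<and> mal_eq_code L m n p q
     then cons_code (div_code p q) r else r)"

definition mal_gens_code :: "nat set \<Rightarrow> nat \<Rightarrow> nat \<Rightarrow> nat" where
  "mal_gens_code L m n = rec_nat 0 (gens_step L m n) (Suc (prod_encode (n, n)))"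

lemma decidable_on_vertex_code:
  "finite L \<Longrightarrow> computable_on k f \<Longrightarrow> computable_on k g \<Longrightarrow>
    decidable_on k (\<lambda>xs. vertex_code L (f xs) (g xs))"
  unfolding vertex_code_def by (intro code_intros decidable_on_valid_code)

lemma decidable_on_rel_code:
  "computable_on k f \<Longrightarrow> computable_on k g \<Longrightarrow> computable_on k h \<Longrightarrow>
    decidable_on k (\<lambda>xs. rel_code (f xs) (g xs) (h xs))"
  unfolding rel_code_def by (intro code_intros)

lemma computable_on_triple_code:
  "computable_on k f \<Longrightarrow> computable_on k g \<Longrightarrow> computable_on k h \<Longrightarrow>
    computable_on k (\<lambda>xs. triple_code (f xs) (g xs) (h xs))"
  unfolding triple_code_def by (intro code_intros)

lemmas graph_code_intros = code_intros decidable_on_vertex_code decidable_on_rel_code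
  computable_on_triple_code decidable_on_entry_code decidable_on_finite

lemma decidable_on_self_continuing_code:
  assumes "finite L" "computable_on k f" "computable_on k g" "computable_on k h"
  shows "decidable_on k (\<lambda>xs. self_continuing_code L m (f xs) (g xs) (h xs))"
  by (rule decidable_on_comp3[of "self_continuing_code L m", OF _ assms(2-)],
      unfold self_continuing_code_def continuable_code_def numeral_3_eq_3)
    (intro graph_code_intros assms(1))

lemma decidable_on_good_code:
  assumes "finite L" "computable_on k f" "computable_on k g"
  shows "decidable_on k (\<lambda>xs. good_code L m (f xs) (g xs))"
  by (rule decidable_on_comp2[of "good_code L m", OF _ assms(2-)],
      unfold good_code_def equiv_code_def fold_code_def numeral_2_eq_2)
    (intro graph_code_intros decidable_on_self_continuing_code assms(1))

lemma decidable_on_mal_eq_code: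
  assumes "finite L" "computable_on k f" "computable_on k g" "computable_on k h"
  shows "decidable_on k (\<lambda>xs. mal_eq_code L m (f xs) (g xs) (h xs))"
  by (rule decidable_on_comp3[of "mal_eq_code L m", OF _ assms(2-)],
      unfold mal_eq_code_def numeral_3_eq_3)
    (intro graph_code_intros decidable_on_good_code assms(1))

text \<open>Only \<open>n\<close> is an input. The alphabet enters through the constants
  \<open>L\<close> and \<open>m\<close>, and membership in a finite set is decidable.\<close>

lemma computable_mal_gens_code:
  assumes "finite L" shows "computable (mal_gens_code L m)"
proof -
  have "computable_on 1 (\<lambda>xs. mal_gens_code L m (hd xs))"
    unfolding mal_gens_code_def gens_step_def Let_def One_nat_def
    by (intro computable_on_rec_nat graph_code_intros decidable_on_mal_eq_code
        computable_on_div_code assms)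
  then obtain r where r: "recursive 1 r"
    "\<And>xs. length xs = 1 \<Longrightarrow> mal_gens_code L m (hd xs) = r xs"
    unfolding computable_on_def by blast
  have "mal_gens_code L m n = r [n]" for n using r(2)[of "[n]"] by simp
  then show ?thesis unfolding computable_def using r(1) by blast
qed

section \<open>Correctness of the coding\<close>

lemma prod_encode_mono: "a \<le> a' \<Longrightarrow> b \<le> b' \<Longrightarrow> prod_encode (a, b) \<le> prod_encode (a', b')"
  by (auto simp: prod_encode_def triangle_def intro!: add_mono div_le_mono mult_le_mono)

lemma triple_code_mono:
  "a \<le> a' \<Longrightarrow> p \<le> p' \<Longrightarrow> q \<le> q' \<Longrightarrow> triple_code a p q \<le> triple_code a' p' q'"
  unfolding triple_code_def by (intro prod_encode_mono)

lemma triple_code_eq_iff [simp]: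
  "triple_code a p q = triple_code a' p' q' \<longleftrightarrow> a = a' \<and> p = p' \<and> q = q'"
  by (auto simp: triple_code_def prod_encode_eq)

lemma set_encode_less:
  assumes "S \<subseteq> {..<B}" shows "set_encode S < 2 ^ B"
proof -
  have "set_encode S \<le> (\<Sum>i<B. 2 ^ i)"
    unfolding set_encode_def using assms by (intro sum_mono2) auto
  also have "\<dots> < (2::nat) ^ B" by (induction B) auto
  finally show ?thesis .
qed

lemma set_decode_less:
  assumes "T < 2 ^ B" "z \<in> set_decode T" shows "z < B"
proof (rule ccontr)
  assume "\<not> z < B"
  then have "(2::nat) ^ B \<le> 2 ^ z" by simp
  then have "T div 2 ^ z = 0" using assms(1) by (simp only: div_less order_less_le_trans)
  then show False using assms(2) by (simp add: set_decode_def)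
qed

lemma cons_code_simps [simp]:
  "hd_code (cons_code a z) = a" "tl_code (cons_code a z) = z" "cons_code a z \<noteq> 0"
  "cons_code a z = cons_code b y \<longleftrightarrow> a = b \<and> z = y"
  by (auto simp: hd_code_def tl_code_def cons_code_def prod_encode_eq)

lemma div_step_cons_code [simp]:
  "div_step (prod_encode (cons_code a z, q)) = prod_encode (z, cancel_code (inv_code a) q)"
  by (simp add: div_step_def)

lemma tl_code_0 [simp]: "tl_code 0 = 0"
proof -
  have "prod_decode (prod_encode (0, 0)) = (0, 0)" by simp
  then show ?thesis by (simp add: tl_code_def prod_encode_def)
qed

lemma cons_code_list_encode: "cons_code a (list_encode l) = list_encode (a # l)"
  by (simp add: cons_code_def)

lemma tl_code_funpow: "(tl_code ^^ i) (list_encode l) = list_encode (drop i l)"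
proof (induction i arbitrary: l)
  case (Suc i)
  show ?case
  proof (cases l)
    case Nil
    have "(tl_code ^^ j) 0 = 0" for j by (induction j) auto
    then show ?thesis using Nil by simp
  next
    case (Cons a l')
    then show ?thesis
      using Suc by (simp add: funpow_Suc_right del: funpow.simps list_encode.simps
          flip: cons_code_list_encode)
  qed
qed simp

lemma length_le_list_encode: "length l \<le> list_encode l"
proof (induction l)
  case (Cons a l)
  then show ?case using le_prod_encode_2[of "list_encode l" a] by simp
qed simp

lemma list_encode_drop:
  "i < length l \<Longrightarrow> list_encode (drop i l) = cons_code (l ! i) (list_encode (drop (Suc i) l))"
  by (simp add: cons_code_list_encode Cons_nth_drop_Suc del: list_encode.simps)

lemma entry_code_iff: "entry_code (list_encode l) u \<longleftrightarrow> u \<in> set l"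
proof -
  have "(\<exists>i<list_encode l. list_encode (drop i l) \<noteq> 0 \<and> hd_code (list_encode (drop i l)) = u)
      \<longleftrightarrow> (\<exists>i<length l. l ! i = u)"
  proof (intro iffI; elim exE conjE)
    fix i assume i: "list_encode (drop i l) \<noteq> 0" "hd_code (list_encode (drop i l)) = u"
    then have "i < length l" by (cases "i < length l") auto
    then show "\<exists>i<length l. l ! i = u" using i by (auto simp: list_encode_drop)
  next
    fix i assume "i < length l" "l ! i = u"
    moreover have "i < list_encode l" using length_le_list_encode[of l] \<open>i < length l\<close> by simp
    ultimately show "\<exists>i<list_encode l. list_encode (drop i l) \<noteq> 0 \<and>
        hd_code (list_encode (drop i l)) = u"
      by (intro exI[of _ i]) (simp add: list_encode_drop)
  qed
  then show ?thesis unfolding entry_code_def tl_code_funpow by (simp add: in_set_conv_nth)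
qed

lemma valid_code_list_encode:
  "valid_code L (list_encode l) \<longleftrightarrow> set l \<subseteq> L \<and> successively (\<lambda>p q. q \<noteq> inv_code p) l"
proof -
  let ?Q = "\<lambda>i. l ! i \<in> L \<and> (Suc i < length l \<longrightarrow> l ! Suc i \<noteq> inv_code (l ! i))"
  let ?P = "\<lambda>v. v \<noteq> 0 \<longrightarrow> hd_code v \<in> L \<and>
    (tl_code v \<noteq> 0 \<longrightarrow> hd_code (tl_code v) \<noteq> inv_code (hd_code v))"
  have P: "?P (list_encode (drop i l)) \<longleftrightarrow> (i < length l \<longrightarrow> ?Q i)" for i
  proof (cases "i < length l")
    case True
    then show ?thesis
      by (cases "Suc i < length l") (simp_all add: list_encode_drop)
  qed simp
  have "valid_code L (list_encode l) \<longleftrightarrow> (\<forall>i<length l. ?Q i)"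
    unfolding valid_code_def Let_def tl_code_funpow P
    using length_le_list_encode[of l] by (meson order_less_le_trans)
  then show ?thesis
    by (auto simp: successively_conv_nth subset_iff in_set_conv_nth)
qed

text \<open>The numbering is injective on \<open>X\<close> only. Hence a code determines a word only
  among words over \<open>X\<close>, which explains the conditions on letters below.\<close>

locale coded_alphabet = free_group_on X for X :: "'a set" +
  fixes e :: "'a \<Rightarrow> nat"
  assumes finite_X: "finite X" and inj_e: "inj_on e X"
begin

definition letter_code :: "'a \<times> bool \<Rightarrow> nat" where
  "letter_code a = prod_encode (e (fst a), of_bool (snd a))"

definition L where "L = letter_code ` (X \<times> UNIV)"

text \<open>\<open>insert 0\<close> keeps the maximum meaningful for an empty alphabet.\<close>

definition m where "m = Max (insert 0 L)"

lemma finite_L: "finite L"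
  using finite_X by (simp add: L_def)

lemma letter_code_L: "a \<in> X \<times> UNIV \<Longrightarrow> letter_code a \<in> L"
  by (simp add: L_def)

lemma L_le: "a \<in> L \<Longrightarrow> a \<le> m"
  using finite_L by (simp add: m_def)

lemma letter_code_eq_iff:
  "a \<in> X \<times> UNIV \<Longrightarrow> b \<in> X \<times> UNIV \<Longrightarrow> letter_code a = letter_code b \<longleftrightarrow> a = b"
  using inj_e by (auto simp: letter_code_def prod_encode_eq inj_on_def)

lemma inv_code_letter_code: "inv_code (letter_code a) = letter_code (inv_letter a)"
  by (simp add: inv_code_def letter_code_def inv_letter_def)

lemma word_code_eq: "word_code e w = list_encode (map letter_code w)"
proof -
  have "(\<lambda>(x, b). prod_encode (e x, of_bool b)) = letter_code"
    by (auto simp: fun_eq_iff letter_code_def)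
  then show ?thesis by (simp add: word_code_def)
qed

lemma word_code_simps [simp]:
  "word_code e [] = 0" "word_code e (a # w) = cons_code (letter_code a) (word_code e w)"
  by (simp_all add: word_code_eq cons_code_def)

lemma word_code_eq_iff:
  "set u \<subseteq> X \<times> UNIV \<Longrightarrow> set w \<subseteq> X \<times> UNIV \<Longrightarrow> word_code e u = word_code e w \<longleftrightarrow> u = w"
proof (induction u arbitrary: w)
  case Nil
  then show ?case by (cases w) (auto dest: sym)
next
  case (Cons a u)
  then show ?case by (cases w) (auto simp: letter_code_eq_iff)
qed

lemma cancel_code_word_code:
  assumes "a \<in> X \<times> UNIV" "set w \<subseteq> X \<times> UNIV"
  shows "cancel_code (letter_code a) (word_code e w) = word_code e (cancel_Cons a w)"
  using assms letter_code_eq_iff[of _ "inv_letter a"]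
  by (cases w) (auto simp: cancel_code_def inv_code_letter_code)

lemma div_code_word_code:
  assumes "p \<in> F" "q \<in> F"
  shows "div_code (word_code e p) (word_code e q) = word_code e (free_inv p \<cdot> q)"
proof -
  have stay: "(div_step ^^ k) (prod_encode (0, z)) = prod_encode (0, z)" for k z
    by (induction k) (auto simp: div_step_def)
  have "(div_step ^^ k) (prod_encode (word_code e p, word_code e q))
      = prod_encode (0, word_code e (foldr cancel_Cons (inv_word p) q))"
    if "set p \<subseteq> X \<times> UNIV" "set q \<subseteq> X \<times> UNIV" "length p \<le> k" for k q
    using that
  proof (induction p arbitrary: q k)
    case Nil
    then show ?case by (simp add: stay)
  next
    case (Cons a p)
    then obtain k' where k: "k = Suc k'" by (cases k) auto
    have a: "inv_letter a \<in> X \<times> UNIV" using Cons.prems(1) by simp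
    have "set (cancel_Cons (inv_letter a) q) \<subseteq> X \<times> UNIV"
      by (rule order_trans[OF set_cancel_Cons]) (use a Cons.prems(2) in simp)
    then have "(div_step ^^ k') (prod_encode (word_code e p,
        word_code e (cancel_Cons (inv_letter a) q)))
      = prod_encode (0, word_code e (foldr cancel_Cons (inv_word (a # p)) q))"
      using Cons k by simp
    then show ?case
      using cancel_code_word_code[OF a Cons.prems(2)]
      by (simp add: k funpow_Suc_right inv_code_letter_code del: funpow.simps)
  qed
  from this[of q "word_code e p"] show ?thesis
    using assms length_le_list_encode[of "map letter_code p"]
    by (simp add: div_code_def mult_foldr free_inv_eq F_iff word_code_eq)
qed

text \<open>Every number codes some list of numbers. What has to be recognised are the entries that
  code letters and the adjacent entries that code inverse letters.\<close>

lemma valid_code_iff: "valid_code L z \<longleftrightarrow> z \<in> word_code e ` F"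
proof -
  have red: "successively (\<lambda>p q. q \<noteq> inv_code p) (map letter_code w) \<longleftrightarrow> reduced w"
    if "set w \<subseteq> X \<times> UNIV" for w
  proof -
    have "letter_code q = inv_code (letter_code p) \<longleftrightarrow> q = inv_letter p"
      if "p \<in> set w" "q \<in> set w" for p q
      using \<open>set w \<subseteq> X \<times> UNIV\<close> that letter_code_eq_iff[of q "inv_letter p"]
        inv_letter_mem_iff[of p X] by (auto simp: inv_code_letter_code)
    then show ?thesis
      unfolding reduced_def successively_map by (intro successively_cong) auto
  qed
  obtain l where z: "z = list_encode l" by (metis list_decode_inverse)
  show ?thesis
  proof
    assume "valid_code L z"
    then have l: "set l \<subseteq> L" "successively (\<lambda>p q. q \<noteq> inv_code p) l"
      unfolding z valid_code_list_encode by simp_all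
    have "l \<in> map letter_code ` lists (X \<times> UNIV)"
      unfolding lists_image[symmetric] using l(1) by (auto simp: L_def lists_eq_set)
    then obtain w where w: "set w \<subseteq> X \<times> UNIV" "l = map letter_code w"
      by (auto simp: lists_eq_set)
    then have "w \<in> F" using l(2) red by (simp add: F_iff)
    then show "z \<in> word_code e ` F" using z w(2) by (auto simp: word_code_eq)
  next
    assume "z \<in> word_code e ` F"
    then obtain w where w: "w \<in> F" "z = list_encode (map letter_code w)"
      by (auto simp: word_code_eq)
    then show "valid_code L z"
      using red[of w] by (auto simp: valid_code_list_encode F_iff L_def)
  qed
qed

text \<open>If \<open>n\<close> codes a list of words, it bounds the code of each entry, so these
  words are vertices. The set is suffix-closed since dropping the first letter does not increase the
  code. Thus the input number itself serves as the size bound of the tree.\<close>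

definition vertices :: "nat \<Rightarrow> 'a word set" where
  "vertices n = {w \<in> F. word_code e w \<le> n}"

lemma vertices_set: "w \<in> vertices n \<Longrightarrow> set w \<subseteq> X \<times> UNIV"
  by (simp add: vertices_def F_iff)

lemma vertices_word_code_eq_iff:
  "u \<in> vertices n \<Longrightarrow> w \<in> vertices n \<Longrightarrow> word_code e u = word_code e w \<longleftrightarrow> u = w"
  by (simp add: word_code_eq_iff vertices_set)

lemma vertices_le: "w \<in> vertices n \<Longrightarrow> word_code e w \<le> n"
  by (simp add: vertices_def)

lemma vertex_code_iff: "vertex_code L n p \<longleftrightarrow> p \<in> word_code e ` vertices n"
  by (auto simp: vertex_code_def valid_code_iff vertices_def)

lemma vertex_code_word_code:
  assumes "set w \<subseteq> X \<times> UNIV" shows "vertex_code L n (word_code e w) \<longleftrightarrow> w \<in> vertices n"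
proof
  assume "vertex_code L n (word_code e w)"
  then obtain v where "v \<in> vertices n" "word_code e w = word_code e v"
    unfolding vertex_code_iff by blast
  then show "w \<in> vertices n" using word_code_eq_iff[OF assms] vertices_set by metis
qed (simp add: vertex_code_iff)

lemma cancel_code_vertex:
  assumes "a \<in> X \<times> UNIV" "p \<in> vertices n"
  shows "cancel_code (letter_code a) (word_code e p) = word_code e (cancel_Cons a p)"
    "vertex_code L n (word_code e (cancel_Cons a p)) \<longleftrightarrow> cancel_Cons a p \<in> vertices n"
proof -
  show "cancel_code (letter_code a) (word_code e p) = word_code e (cancel_Cons a p)"
    by (rule cancel_code_word_code[OF assms(1) vertices_set[OF assms(2)]])
  have "set (cancel_Cons a p) \<subseteq> X \<times> UNIV"
    using set_cancel_Cons[of a p] vertices_set[OF assms(2)] assms(1) by auto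
  then show "vertex_code L n (word_code e (cancel_Cons a p)) \<longleftrightarrow> cancel_Cons a p \<in> vertices n"
    by (rule vertex_code_word_code)
qed

lemma all_vertex_iff:
  "(\<forall>p<Suc n. vertex_code L n p \<longrightarrow> P p) \<longleftrightarrow> (\<forall>w\<in>vertices n. P (word_code e w))"
  by (auto simp: vertex_code_iff less_Suc_eq_le vertices_le)

lemma ex_vertex_iff:
  "(\<exists>p<Suc n. vertex_code L n p \<and> P p) \<longleftrightarrow> (\<exists>w\<in>vertices n. P (word_code e w))"
  unfolding vertex_code_iff less_Suc_eq_le using vertices_le by blast

lemma all_letter_iff:
  "(\<forall>a<Suc m. a \<in> L \<longrightarrow> P a) \<longleftrightarrow> (\<forall>a\<in>X \<times> UNIV. P (letter_code a))"
  using L_le unfolding less_Suc_eq_le L_def by blast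

lemma ex_letter_iff:
  "(\<exists>a<Suc m. a \<in> L \<and> P a) \<longleftrightarrow> (\<exists>a\<in>X \<times> UNIV. P (letter_code a))"
  using L_le unfolding less_Suc_eq_le L_def by blast

lemma finite_vertices: "finite (vertices n)"
proof (rule finite_imageD)
  show "finite (word_code e ` vertices n)"
    by (rule finite_subset[of _ "{..n}"]) (auto simp: vertices_def)
  show "inj_on (word_code e) (vertices n)"
    by (rule inj_onI) (simp add: vertices_word_code_eq_iff)
qed

lemma vertices_subset: "vertices n \<subseteq> F"
  by (auto simp: vertices_def)

lemma Nil_vertices: "[] \<in> vertices n"
  by (simp add: vertices_def)

lemma suffix_vertices: "\<forall>a p. a # p \<in> vertices n \<longrightarrow> p \<in> vertices n"
proof (intro allI impI)
  fix a p assume "a # p \<in> vertices n"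
  then show "p \<in> vertices n"
    using Cons_mult(2)[of a p] le_prod_encode_2[of "word_code e p" "letter_code a"]
    by (simp add: vertices_def cons_code_def)
qed

section \<open>Coded relations and sets of triples against genuine ones\<close>

definition word_rel :: "nat \<Rightarrow> nat \<Rightarrow> ('a word \<times> 'a word) set" where
  "word_rel n s = {(p, q). p \<in> vertices n \<and> q \<in> vertices n \<and>
     rel_code s (word_code e p) (word_code e q)}"

definition word_triples :: "nat \<Rightarrow> nat \<Rightarrow> (('a \<times> bool) \<times> 'a word \<times> 'a word) set" where
  "word_triples n T = {(a, p, q). a \<in> X \<times> UNIV \<and> p \<in> vertices n \<and> q \<in> vertices n \<and>
     triple_code (letter_code a) (word_code e p) (word_code e q) \<in> set_decode T}"

lemma rel_code_iff:
  "p \<in> vertices n \<Longrightarrow> q \<in> vertices n \<Longrightarrow>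
    rel_code s (word_code e p) (word_code e q) \<longleftrightarrow> (p, q) \<in> word_rel n s"
  by (simp add: word_rel_def)

lemma equiv_code_iff: "equiv_code L n s \<longleftrightarrow> equiv (vertices n) (word_rel n s)"
proof -
  have "equiv_code L n s \<longleftrightarrow> (\<forall>p\<in>vertices n. (p, p) \<in> word_rel n s \<and>
    (\<forall>q\<in>vertices n. (p, q) \<in> word_rel n s \<longrightarrow> (q, p) \<in> word_rel n s \<and>
      (\<forall>r\<in>vertices n. (q, r) \<in> word_rel n s \<longrightarrow> (p, r) \<in> word_rel n s)))"
    unfolding equiv_code_def all_vertex_iff by (simp add: rel_code_iff cong: ball_cong)
  moreover have "word_rel n s \<subseteq> vertices n \<times> vertices n" by (auto simp: word_rel_def)
  ultimately show ?thesis
    unfolding equiv_def refl_on_def sym_def trans_def by blast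
qed

lemma fold_code_iff:
  "fold_code L m n s \<longleftrightarrow> (\<forall>a\<in>X \<times> UNIV. \<forall>p q. (p, q) \<in> word_rel n s \<longrightarrow>
     cancel_Cons a p \<in> vertices n \<longrightarrow> cancel_Cons a q \<in> vertices n \<longrightarrow>
     (cancel_Cons a p, cancel_Cons a q) \<in> word_rel n s)"
proof -
  have "fold_code L m n s \<longleftrightarrow> (\<forall>a\<in>X \<times> UNIV. \<forall>p\<in>vertices n. \<forall>q\<in>vertices n. (p, q) \<in> word_rel n s \<longrightarrow>
     cancel_Cons a p \<in> vertices n \<longrightarrow> cancel_Cons a q \<in> vertices n \<longrightarrow>
     (cancel_Cons a p, cancel_Cons a q) \<in> word_rel n s)"
    unfolding fold_code_def all_vertex_iff all_letter_iff
    by (intro ball_cong refl) (simp add: rel_code_iff cancel_code_vertex cong: imp_cong)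
  then show ?thesis by (auto simp: word_rel_def)
qed

text \<open>The coded test rejects elements of \<open>T\<close> that are not triples of a letter and
  two vertices, whence the first conjunct. It ensures that an empty set of genuine triples comes
  from \<open>T = 0\<close> alone.\<close>

lemma self_continuing_code_iff:
  assumes "set_decode T \<subseteq> {..triple_code m n n}"
  shows "self_continuing_code L m n s T \<longleftrightarrow>
    set_decode T = (\<lambda>(a, p, q). triple_code (letter_code a) (word_code e p) (word_code e q))
      ` word_triples n T \<and>
    self_continuing (vertices n) (word_rel n s) (word_triples n T)"
proof -
  let ?c = "\<lambda>a p q. triple_code (letter_code a) (word_code e p) (word_code e q)"
  let ?P = "\<lambda>a p q. cancel_Cons a p \<in> vertices n \<and> cancel_Cons a q \<in> vertices n \<and>
    (p, q) \<notin> word_rel n s \<and> (\<exists>(b, p', q')\<in>word_triples n T. b \<noteq> inv_letter a \<and>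
      (cancel_Cons a p, p') \<in> word_rel n s \<and> (cancel_Cons a q, q') \<in> word_rel n s)"
  have cont: "continuable_code L m n s T (letter_code a) (word_code e p) (word_code e q) \<longleftrightarrow>
      (\<exists>(b, p', q')\<in>word_triples n T. b \<noteq> inv_letter a \<and>
        (cancel_Cons a p, p') \<in> word_rel n s \<and> (cancel_Cons a q, q') \<in> word_rel n s)"
    if "a \<in> X \<times> UNIV" "p \<in> vertices n" "q \<in> vertices n" "cancel_Cons a p \<in> vertices n"
      "cancel_Cons a q \<in> vertices n" for a p q
  proof -
    have "letter_code b = inv_code (letter_code a) \<longleftrightarrow> b = inv_letter a" if "b \<in> X \<times> UNIV" for b
      using letter_code_eq_iff[OF that, of "inv_letter a"] \<open>a \<in> X \<times> UNIV\<close>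
      by (simp add: inv_code_letter_code)
    then show ?thesis
      unfolding continuable_code_def ex_vertex_iff ex_letter_iff cancel_code_vertex[OF that(1,2)]
        cancel_code_vertex[OF that(1,3)]
      using that(4,5) by (auto simp: rel_code_iff word_triples_def)
  qed
  have "self_continuing_code L m n s T \<longleftrightarrow>
      (\<forall>z<Suc (triple_code m n n). z \<in> set_decode T \<longrightarrow>
        (\<exists>a\<in>X \<times> UNIV. \<exists>p\<in>vertices n. \<exists>q\<in>vertices n. z = ?c a p q \<and> ?P a p q))"
    unfolding self_continuing_code_def ex_vertex_iff ex_letter_iff
    by (intro all_cong imp_cong refl bex_cong)
      (simp add: rel_code_iff cancel_code_vertex cont cong: conj_cong)
  also have "\<dots> \<longleftrightarrow> (\<forall>z\<in>set_decode T.
        \<exists>a\<in>X \<times> UNIV. \<exists>p\<in>vertices n. \<exists>q\<in>vertices n. z = ?c a p q \<and> ?P a p q)"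
    using assms by (auto simp: less_Suc_eq_le subset_iff)
  also have "\<dots> \<longleftrightarrow> set_decode T = (\<lambda>(a, p, q). ?c a p q) ` word_triples n T \<and>
    self_continuing (vertices n) (word_rel n s) (word_triples n T)" (is "?l \<longleftrightarrow> ?r")
  proof
    assume l: ?l
    have "set_decode T = (\<lambda>(a, p, q). ?c a p q) ` word_triples n T"
    proof (rule subset_antisym; rule subsetI)
      fix z assume z: "z \<in> set_decode T"
      then obtain a p q where "a \<in> X \<times> UNIV" "p \<in> vertices n" "q \<in> vertices n" "z = ?c a p q"
        using l by blast
      then show "z \<in> (\<lambda>(a, p, q). ?c a p q) ` word_triples n T"
        using z by (intro image_eqI[of _ _ "(a, p, q)"]) (auto simp: word_triples_def)
    qed (auto simp: word_triples_def)
    moreover have "self_continuing (vertices n) (word_rel n s) (word_triples n T)"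
      unfolding self_continuing_def
    proof (rule ballI, clarify)
      fix a b p q assume "((a, b), p, q) \<in> word_triples n T"
      then have *: "(a, b) \<in> X \<times> UNIV" "p \<in> vertices n" "q \<in> vertices n"
        "?c (a, b) p q \<in> set_decode T"
        by (auto simp: word_triples_def)
      obtain a' p' q' where a': "a' \<in> X \<times> UNIV" "p' \<in> vertices n" "q' \<in> vertices n"
        "?c (a, b) p q = ?c a' p' q'" "?P a' p' q'"
        using l[rule_format, OF *(4)] by blast
      then have "(a, b) = a'" "p = p'" "q = q'"
        using * letter_code_eq_iff word_code_eq_iff vertices_set by simp_all
      then show "(a, b) \<in> X \<times> UNIV \<and> p \<in> vertices n \<and> q \<in> vertices n \<and> ?P (a, b) p q"
        using a' by blast
    qed
    ultimately show ?r by blast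
  next
    assume r: ?r
    show ?l
    proof
      fix z assume "z \<in> set_decode T"
      then obtain a p q where "(a, p, q) \<in> word_triples n T" "z = ?c a p q"
        using r by auto
      then show "\<exists>a\<in>X \<times> UNIV. \<exists>p\<in>vertices n. \<exists>q\<in>vertices n. z = ?c a p q \<and> ?P a p q"
        using r unfolding self_continuing_def by blast
    qed
  qed
  finally show ?thesis .
qed

lemma no_self_continuing_code_iff:
  "(\<forall>T<2 ^ Suc (triple_code m n n). self_continuing_code L m n s T \<longrightarrow> T = 0) \<longleftrightarrow>
     (\<forall>T. self_continuing (vertices n) (word_rel n s) T \<longrightarrow> T = {})" (is "?l \<longleftrightarrow> ?r")
proof
  let ?c = "\<lambda>(a, p, q). triple_code (letter_code a) (word_code e p) (word_code e q)"
  assume l: ?l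
  show ?r
  proof (intro allI impI)
    fix T assume T: "self_continuing (vertices n) (word_rel n s) T"
    then have TV: "T \<subseteq> (X \<times> UNIV) \<times> vertices n \<times> vertices n"
      unfolding self_continuing_def by fastforce
    then have fin: "finite (?c ` T)"
      using finite_X finite_vertices by (meson finite_SigmaI finite_UNIV finite_imageI finite_subset)
    have le: "?c ` T \<subseteq> {..triple_code m n n}"
      using TV vertices_le L_le letter_code_L by (force intro!: triple_code_mono)
    define N where "N = set_encode (?c ` T)"
    have dec: "set_decode N = ?c ` T" unfolding N_def using fin by simp
    have "word_triples n N = T"
    proof -
      have "(a, p, q) \<in> T" if "(a, p, q) \<in> word_triples n N" for a p q
      proof -
        have *: "a \<in> X \<times> UNIV" "p \<in> vertices n" "q \<in> vertices n" "?c (a, p, q) \<in> ?c ` T"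
          using that by (auto simp: word_triples_def dec)
        then obtain a' p' q' where "(a', p', q') \<in> T" "?c (a, p, q) = ?c (a', p', q')" by auto
        moreover from this have "a' \<in> X \<times> UNIV" "p' \<in> vertices n" "q' \<in> vertices n" using TV by auto
        ultimately show ?thesis
          using * letter_code_eq_iff word_code_eq_iff vertices_set by simp
      qed
      moreover have "(a, p, q) \<in> word_triples n N" if "(a, p, q) \<in> T" for a p q
        using that TV by (force simp: word_triples_def dec)
      ultimately show ?thesis by auto
    qed
    then have "self_continuing_code L m n s N"
      using self_continuing_code_iff[of N n s] dec le T by simp
    moreover have "N < 2 ^ Suc (triple_code m n n)"
      unfolding N_def using le by (intro set_encode_less) (auto simp: less_Suc_eq_le)
    ultimately have "N = 0" using l by blast
    then show "T = {}" using dec by simp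
  qed
next
  assume r: ?r
  show ?l
  proof (intro allI impI)
    fix T assume T: "T < 2 ^ Suc (triple_code m n n)" "self_continuing_code L m n s T"
    have "set_decode T \<subseteq> {..triple_code m n n}"
      using set_decode_less[OF T(1)] by (auto simp: less_Suc_eq_le)
    from T(2)[unfolded self_continuing_code_iff[OF this]] have "set_decode T = {}"
      using r by auto
    then show "T = 0" by (metis set_decode_inverse set_encode_empty)
  qed
qed

text \<open>The tree axioms hold for every \<open>vertices n\<close>, so only the equivalence,
  folding and continuation conditions have to be tested.\<close>

lemma good_code_iff:
  "good_code L m n s \<longleftrightarrow> malnormal_tree X (vertices n) (word_rel n s) \<and>
     (\<forall>u\<in>vertices n. entry_code n (word_code e u) \<longrightarrow> (u, []) \<in> word_rel n s)"
proof -
  have "malnormal_tree X (vertices n) (word_rel n s) \<longleftrightarrow>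
    equiv_code L n s \<and> fold_code L m n s \<and>
    (\<forall>T<2 ^ Suc (triple_code m n n). self_continuing_code L m n s T \<longrightarrow> T = 0)"
    unfolding equiv_code_iff fold_code_iff no_self_continuing_code_iff
      malnormal_tree_def malnormal_tree_axioms_def folded_tree_def
    using vertices_subset Nil_vertices suffix_vertices by blast
  moreover have "(\<forall>u<Suc n. vertex_code L n u \<longrightarrow> entry_code n u \<longrightarrow> rel_code s u 0) \<longleftrightarrow>
     (\<forall>u\<in>vertices n. entry_code n (word_code e u) \<longrightarrow> (u, []) \<in> word_rel n s)"
    unfolding all_vertex_iff using rel_code_iff[OF _ Nil_vertices] by simp
  ultimately show ?thesis unfolding good_code_def by blast
qed

lemma mal_eq_code_iff:
  assumes p: "p \<in> vertices n" and q: "q \<in> vertices n"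
  defines "U \<equiv> {u \<in> vertices n. entry_code n (word_code e u)}"
  shows "mal_eq_code L m n (word_code e p) (word_code e q) \<longleftrightarrow>
    (p, q) \<in> coset_relation (vertices n) (mal (free_group X) (generate (free_group X) U))"
proof -
  have "(\<forall>s<2 ^ Suc (prod_encode (n, n)). good_code L m n s \<longrightarrow>
      rel_code s (word_code e p) (word_code e q)) \<longleftrightarrow>
    (\<forall>E. malnormal_tree X (vertices n) E \<longrightarrow> (\<forall>u\<in>U. (u, []) \<in> E) \<longrightarrow> (p, q) \<in> E)" (is "?l \<longleftrightarrow> ?r")
  proof
    assume l: ?l
    show ?r
    proof (intro allI impI)
      fix E assume E: "malnormal_tree X (vertices n) E" "\<forall>u\<in>U. (u, []) \<in> E"
      interpret T: malnormal_tree X "vertices n" E by (rule E(1))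
      let ?c = "\<lambda>(p, q). prod_encode (word_code e p, word_code e q)"
      have EV: "E \<subseteq> vertices n \<times> vertices n" using T.E_V by auto
      then have fin: "finite (?c ` E)"
        using finite_vertices by (meson finite_SigmaI finite_imageI finite_subset)
      \<comment> \<open>Every relation on the vertices has a code below the search bound, so the
        bounded search misses no good relation.\<close>
      define s where "s = set_encode (?c ` E)"
      have "?c ` E \<subseteq> {..<Suc (prod_encode (n, n))}"
        using EV vertices_le by (force simp: less_Suc_eq_le intro!: prod_encode_mono)
      then have s: "s < 2 ^ Suc (prod_encode (n, n))"
        unfolding s_def by (rule set_encode_less)
      have "word_rel n s = E"
      proof -
        have dec: "set_decode s = ?c ` E" unfolding s_def using fin by simp
        have "(p, q) \<in> E" if pq: "p \<in> vertices n" "q \<in> vertices n"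
          "prod_encode (word_code e p, word_code e q) \<in> ?c ` E" for p q
        proof -
          obtain p' q' where "(p', q') \<in> E"
            "prod_encode (word_code e p, word_code e q) = prod_encode (word_code e p', word_code e q')"
            using pq(3) by auto
          moreover from this have "p' \<in> vertices n" "q' \<in> vertices n" using EV by auto
          ultimately show ?thesis
            using pq word_code_eq_iff vertices_set by (simp add: prod_encode_eq)
        qed
        then have "word_rel n s \<subseteq> E" unfolding word_rel_def rel_code_def dec by blast
        moreover have "E \<subseteq> word_rel n s"
          using EV by (force simp: word_rel_def rel_code_def dec)
        ultimately show ?thesis by blast
      qed
      moreover from this have "good_code L m n s"
        unfolding good_code_iff using E by (auto simp: U_def)
      ultimately show "(p, q) \<in> E" using l s p q rel_code_iff by blast
    qed
  next
    assume r: ?r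
    show ?l
    proof (intro allI impI)
      fix s assume "good_code L m n s"
      then have "(p, q) \<in> word_rel n s"
        using r unfolding good_code_iff U_def by blast
      then show "rel_code s (word_code e p) (word_code e q)" by (simp add: word_rel_def)
    qed
  qed
  moreover have U: "U \<subseteq> vertices n" by (auto simp: U_def)
  ultimately show ?thesis
    unfolding mal_eq_code_def mal_tree(2)[OF finite_X finite_vertices vertices_subset Nil_vertices
        suffix_vertices U] by blast
qed

lemma mal_gens_code_words:
  assumes us: "set us \<subseteq> F"
  shows "\<exists>vs. set vs \<subseteq> F \<and> mal_gens_code L m (words_code e us) = words_code e vs \<and>
    generate (free_group X) (set vs) = mal (free_group X) (generate (free_group X) (set us))"
proof -
  define n where "n = words_code e us"
  define M where "M = mal (free_group X) (generate (free_group X) (set us))"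
  let ?E = "coset_relation (vertices n) M"
  have n: "n = list_encode (map (word_code e) us)" by (simp add: n_def words_code_def)
  have le: "u \<le> list_encode l" if "u \<in> set l" for u l
    using that
  proof (induction l)
    case (Cons a l)
    then show ?case
      using le_prod_encode_1[of a "list_encode l"] le_prod_encode_2[of "list_encode l" a] by auto
  qed simp
  have us_V: "set us \<subseteq> vertices n"
    using us le[of _ "map (word_code e) us"] by (auto simp: vertices_def n)
  \<comment> \<open>Injectivity of the coding on vertices ensures that the entries of
    \<open>n\<close> come from the given words only.\<close>
  have U: "{u \<in> vertices n. entry_code n (word_code e u)} = set us"
  proof -
    have "u \<in> set us" if u: "u \<in> vertices n" "word_code e u \<in> word_code e ` set us" for u
    proof -
      obtain v where v: "v \<in> set us" "word_code e u = word_code e v" using u(2) by blast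
      then have "v \<in> vertices n" using us_V by blast
      then have "u = v" using v(2) vertices_word_code_eq_iff[OF u(1)] by blast
      then show ?thesis using v(1) by simp
    qed
    then show ?thesis using us_V unfolding n entry_code_iff by auto
  qed
  have eq: "mal_eq_code L m n (word_code e p) (word_code e q) \<longleftrightarrow> (p, q) \<in> ?E"
    if "p \<in> vertices n" "q \<in> vertices n" for p q
    using mal_eq_code_iff[OF that] unfolding U M_def .
  \<comment> \<open>The generators collected in the first \<open>k\<close> rounds; round
    \<open>z\<close> treats the pair coded by \<open>z\<close>.\<close>
  define S where "S k = {free_inv p \<cdot> q | p q. (p, q) \<in> ?E \<and>
    prod_encode (word_code e p, word_code e q) < k}" for k
  have EV: "p \<in> vertices n" "q \<in> vertices n" if "(p, q) \<in> ?E" for p q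
    using that by (auto simp: coset_relation_def)
  have "\<exists>vs. set vs = S k \<and> rec_nat 0 (gens_step L m n) k = words_code e vs" for k
  proof (induction k)
    case 0
    then show ?case by (intro exI[of _ "[]"]) (auto simp: S_def words_code_def)
  next
    case (Suc k)
    then obtain vs where vs: "set vs = S k" "rec_nat 0 (gens_step L m n) k = words_code e vs"
      by blast
    show ?case
    proof (cases "\<exists>p q. (p, q) \<in> ?E \<and> k = prod_encode (word_code e p, word_code e q)")
      case True
      then obtain p q where pq: "(p, q) \<in> ?E" "k = prod_encode (word_code e p, word_code e q)"
        by blast
      have "gens_step L m n k (words_code e vs) = words_code e (free_inv p \<cdot> q # vs)"
        using pq EV[OF pq(1)] eq vertices_subset
        by (auto simp: gens_step_def vertex_code_iff div_code_word_code words_code_def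
            cons_code_def subset_iff)
      moreover have "S (Suc k) = insert (free_inv p \<cdot> q) (S k)"
      proof -
        have "p' = p \<and> q' = q"
          if "(p', q') \<in> ?E" "prod_encode (word_code e p', word_code e q') = k" for p' q'
          using that pq vertices_word_code_eq_iff[OF EV(1) EV(1)]
            vertices_word_code_eq_iff[OF EV(2) EV(2)]
          by (simp add: prod_encode_eq)
        then show ?thesis using pq by (auto simp: S_def less_Suc_eq)
      qed
      ultimately show ?thesis using vs by (intro exI[of _ "free_inv p \<cdot> q # vs"]) simp
    next
      case False
      have "gens_step L m n k r = r" for r
      proof -
        obtain x y where k: "k = prod_encode (x, y)" by (metis prod_decode_inverse surj_pair)
        have "\<not> (vertex_code L n x \<and> vertex_code L n y \<and> mal_eq_code L m n x y)"
          using False eq unfolding k vertex_code_iff by blast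
        then show ?thesis by (auto simp: gens_step_def k)
      qed
      moreover have "S (Suc k) = S k" using False by (auto simp: S_def less_Suc_eq)
      ultimately show ?thesis using vs by auto
    qed
  qed
  then obtain vs where vs: "set vs = S (Suc (prod_encode (n, n)))"
    "mal_gens_code L m n = words_code e vs"
    unfolding mal_gens_code_def by blast
  have "prod_encode (word_code e p, word_code e q) < Suc (prod_encode (n, n))"
    if "(p, q) \<in> ?E" for p q
    unfolding less_Suc_eq_le by (intro prod_encode_mono vertices_le EV[OF that])
  then have "set vs = {free_inv p \<cdot> q | p q. (p, q) \<in> ?E}"
    unfolding vs(1) S_def by blast
  moreover have "{free_inv p \<cdot> q | p q. (p, q) \<in> ?E} \<subseteq> F"
  proof clarify
    fix p q assume "(p, q) \<in> ?E"
    then have "p \<in> F" "q \<in> F" using EV vertices_subset by blast+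
    then show "free_inv p \<cdot> q \<in> F" by simp
  qed
  moreover have "generate (free_group X) {free_inv p \<cdot> q | p q. (p, q) \<in> ?E} = M"
    unfolding M_def
    by (rule mal_tree(1)[OF finite_X finite_vertices vertices_subset Nil_vertices suffix_vertices us_V])
  ultimately show ?thesis
    using vs(2) unfolding n_def M_def by (intro exI[of _ vs]) (simp only: simp_thms)
qed

end

theorem theorem13p6:
  fixes X :: "'a set"
  assumes "finite X"
  shows "(\<forall>K. subgroup K (free_group X) \<and> finitely_generated (free_group X) K \<longrightarrow>
            (let \<A> = {H. algebraic_extension (free_group X) K H \<and> malnormal (free_group X) H}
             in (\<exists>!M. inclusion_minimal \<A> M) \<and>
                (\<forall>M. inclusion_minimal \<A> M \<longrightarrow> M = mal (free_group X) K)) \<and>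
            finitely_generated (free_group X) (mal (free_group X) K) \<and>
            algebraic_extension (free_group X) K (mal (free_group X) K)) \<and>
         (\<forall>e :: 'a \<Rightarrow> nat. inj_on e X \<longrightarrow>
            (\<exists>f. computable f \<and>
               (\<forall>us. set us \<subseteq> carrier (free_group X) \<longrightarrow>
                  (\<exists>vs. set vs \<subseteq> carrier (free_group X) \<and>
                        f (words_code e us) = words_code e vs \<and>
                        generate (free_group X) (set vs)
                          = mal (free_group X) (generate (free_group X) (set us))))))"
proof (intro conjI allI impI)
  interpret free_group_on X .
  fix K assume K: "subgroup K (free_group X) \<and> finitely_generated (free_group X) K"
  let ?M = "mal (free_group X) K"
  let ?A = "{H. algebraic_extension (free_group X) K H \<and> malnormal (free_group X) H}"
  show fg: "finitely_generated (free_group X) ?M"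
    using finitely_generated_mal[OF assms] K by blast
  show alg: "algebraic_extension (free_group X) K ?M"
    using algebraic_extension_mal K by blast
  have "?M \<in> ?A"
    using alg malnormal_mal subgroup.subset K by blast
  moreover have "?M \<subseteq> H" if "H \<in> ?A" for H
    using that mal_subset by (auto simp: algebraic_extension_def)
  \<comment> \<open>A least element of a family is its only minimal one.\<close>
  ultimately have "inclusion_minimal ?A = (\<lambda>M. M = ?M)"
    unfolding inclusion_minimal_def fun_eq_iff by blast
  then show "let \<A> = ?A in (\<exists>!M. inclusion_minimal \<A> M) \<and>
      (\<forall>M. inclusion_minimal \<A> M \<longrightarrow> M = ?M)"
    unfolding Let_def by (simp only:) blast
next
  fix e :: "'a \<Rightarrow> nat" assume e: "inj_on e X"
  interpret coded_alphabet X e by unfold_locales (use assms e in auto)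
  show "\<exists>f. computable f \<and>
     (\<forall>us. set us \<subseteq> carrier (free_group X) \<longrightarrow>
        (\<exists>vs. set vs \<subseteq> carrier (free_group X) \<and> f (words_code e us) = words_code e vs \<and>
           generate (free_group X) (set vs)
             = mal (free_group X) (generate (free_group X) (set us))))"
    \<comment> \<open>The witness is \<open>mal_gens_code L m\<close>, which depends on the alphabet
      and its numbering but not on the generators.\<close>
    using computable_mal_gens_code[OF finite_L] mal_gens_code_words by blast
qed

end
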